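(* Let $\alpha\in[0,\pi/2)$, $A\in\Pi^n_{s,\alpha}$, $q\in\mathbb{C}$ with $0<|q|\le1$, and $t\in[0,1]$. Then (a) $|q|^{t+1}\cos^t(\alpha)\,w_q^t(A)\le |q|^t w_q(A^t)\le \sec^{2t}(\alpha)\sec(t\alpha)\,w_q^t(A)$, and (b) $|q|^{t+1}\cos(t\alpha)\cos^{2t}(\alpha)\,w_q^{-t}(A)\le w_q(A^{-t})$.
   Context: $M_n$ is the algebra of complex $n\times n$ matrices. For $|q|\le1$, $w_q(A)=\sup\{|\langle Ax,y\rangle|: \|x\|=\|y\|=1,\ \langle x,y\rangle=q\}$, and $w_q^t(A)$ denotes $(w_q(A))^t$. $W(A)=\{\langle Ax,x\rangle:\|x\|=1\}$, $S_\alpha=\{z:\operatorname{Re}z>0,\ |\operatorname{Im}z|\le\tan(\alpha)\operatorname{Re}z\}$ and $\Pi^n_{s,\alpha}=\{A\in M_n: W(A)\subseteq S_\alpha\}$. Such $A$ has no eigenvalues on $(-\infty,0]$ and $A^{t}$, $A^{-t}$ denote the principal fractional powers. *)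

theory Defs
  imports "HOL-Analysis.Analysis" "Jordan_Normal_Form.Matrix" "Jordan_Normal_Form.Char_Poly"
begin

text \<open>Inner product convention: <x,y> = x \<bullet>c y = sum_i x_i * cnj (y_i).\<close>

definition num_range :: "complex mat \<Rightarrow> complex set" where
  "num_range A = {(A *\<^sub>v x) \<bullet>c x | x. x \<in> carrier_vec (dim_col A) \<and> x \<bullet>c x = 1}"

definition q_num_radius :: "complex \<Rightarrow> complex mat \<Rightarrow> real" where
  "q_num_radius q A = Sup (insert 0 {cmod ((A *\<^sub>v x) \<bullet>c y) | x y.
      x \<in> carrier_vec (dim_col A) \<and> y \<in> carrier_vec (dim_col A) \<and>
      x \<bullet>c x = 1 \<and> y \<bullet>c y = 1 \<and> x \<bullet>c y = q})"

definition sector :: "real \<Rightarrow> complex set" where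
  "sector \<alpha> = {z. 0 < Re z \<and> \<bar>Im z\<bar> \<le> tan \<alpha> * Re z}"

definition Pi_s :: "nat \<Rightarrow> real \<Rightarrow> complex mat set" where
  "Pi_s n \<alpha> = {A \<in> carrier_mat n n. num_range A \<subseteq> sector \<alpha>}"

definition mat_poly_eval :: "complex poly \<Rightarrow> complex mat \<Rightarrow> complex mat" where
  "mat_poly_eval p A = foldr (\<lambda>c M. c \<cdot>\<^sub>m 1\<^sub>m (dim_row A) + A * M) (coeffs p)
      (0\<^sub>m (dim_row A) (dim_row A))"

text \<open>Primary matrix function f(A) = p(A), p a Hermite interpolating polynomial of f on the
  spectrum (Higham, Def. 1.4), for f(z) = z powr t (principal branch).\<close>
definition principal_pow :: "real \<Rightarrow> complex mat \<Rightarrow> complex mat" where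
  "principal_pow t A = (THE B. \<exists>p.
     (\<forall>e. poly (char_poly A) e = 0 \<longrightarrow>
        (\<forall>j < order e (char_poly A).
           (deriv ^^ j) (poly p) e = (deriv ^^ j) (\<lambda>z. z powr complex_of_real t) e))
     \<and> B = mat_poly_eval p A)"

end

theory Submission
  imports Defs "HOL-Complex_Analysis.Complex_Analysis" "HOL-Real_Asymp.Real_Asymp"
begin

text \<open>
  Let \<open>r\<close> be the largest value of \<open>Re \<langle>A x, x\<rangle>\<close> over unit vectors. Sectoriality gives
  \<open>\<bar>\<langle>A u, v\<rangle>\<bar> \<le> (Re \<langle>A u, u\<rangle> + Re \<langle>A v, v\<rangle>) / (2 cos \<alpha>)\<close>, hence \<open>\<parallel>A\<parallel> \<le> r / cos \<alpha>\<close> and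
  \<open>\<parallel>A u\<parallel>\<^sup>2 \<le> m Re \<langle>A u, u\<rangle>\<close> with \<open>m = r / cos\<^sup>2 \<alpha>\<close>. The latter bounds \<open>A (s + A)\<^sup>-\<^sup>1\<close> by
  \<open>m / (s + m)\<close> in norm, while at a maximizer \<open>x\<close> of the quadratic form
  \<open>Re \<langle>A (s + A)\<^sup>-\<^sup>1 x, x\<rangle> \<ge> r / (s + r)\<close>. For \<open>0 < t < 1\<close> the function \<open>z\<^bsup>t\<^esup>\<close> is a locally uniform limit
  of positive mixtures of the functions \<open>z / (s + z)\<close>, so that \<open>\<parallel>A\<^bsup>t\<^esup>\<parallel> \<le> m\<^bsup>t\<^esup>\<close> and
  \<open>Re \<langle>A\<^bsup>t\<^esup> x, x\<rangle> \<ge> r\<^bsup>t\<^esup>\<close>. To pass to the limit, \<open>\<langle>f(A) x, y\<rangle>\<close> is written as a fixed linear combination of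
  the derivatives \<open>f\<^bsup>(j)\<^esup>(e)\<close> at the eigenvalues. Part (a) follows from
  \<open>\<bar>q\<bar> \<bar>\<langle>M x, x\<rangle>\<bar> \<le> w\<^sub>q(M) \<le> \<parallel>M\<parallel>\<close>; part (b) follows by evaluating at an eigenvector. If \<open>n = 0\<close>, or
  \<open>n = 1\<close> and \<open>\<bar>q\<bar> < 1\<close>, no admissible pair exists and every radius is \<open>0\<close>.
\<close>

section \<open>Fractional powers as limits of positive mixtures\<close>

text \<open>Since \<open>z / (s + z) = 1 - s / (s + z)\<close>, derivatives of positive order come
  from the simple pole at \<open>-s\<close> alone, which explains the two cases of this closed form
  for the \<open>j\<close>-th derivative in \<open>z\<close>.\<close>

definition pow_kernel_deriv :: "nat \<Rightarrow> real \<Rightarrow> complex \<Rightarrow> complex" where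
  "pow_kernel_deriv j s z = (case j of 0 \<Rightarrow> z / (of_real s + z)
     | Suc i \<Rightarrow> of_real s * (-1) ^ i * fact (Suc i) / (of_real s + z) ^ (i + 2))"

text \<open>The integral \<open>\<integral>\<^sub>0\<^sup>\<infinity> s\<^bsup>t-1\<^esup> z / (s + z) ds\<close>, a multiple of \<open>z\<^bsup>t\<^esup>\<close>, after the
  substitution \<open>s = e\<^bsup>u\<^esup>\<close> and truncated to \<open>\<bar>u\<bar> \<le> N\<close>.\<close>
definition pow_approx :: "real \<Rightarrow> real \<Rightarrow> complex \<Rightarrow> complex" where
  "pow_approx t N z = integral {-N..N} (\<lambda>u. of_real (exp (t * u)) * (z / (of_real (exp u) + z)))"

section \<open>Derivatives of the kernel and of the truncated integral\<close>

lemma of_real_add_nonzero: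
  assumes "Re z > 0" "s > 0"
  shows "of_real s + z \<noteq> 0"
  using assms by (auto simp: complex_eq_iff)

lemma pow_kernel_deriv_has_field_derivative:
  assumes "Re z > 0" "s > 0"
  shows "(pow_kernel_deriv j s has_field_derivative pow_kernel_deriv (Suc j) s z) (at z)"
proof (cases j)
  case 0
  have "((\<lambda>z. z / (of_real s + z)) has_field_derivative of_real s / (of_real s + z) ^ 2) (at z)"
    using of_real_add_nonzero[OF assms]
    by (auto intro!: derivative_eq_intros simp: power2_eq_square)
  then show ?thesis
    by (simp add: 0 pow_kernel_deriv_def[abs_def] numeral_2_eq_2)
next
  case (Suc i)
  let ?c = "of_real s * (-1) ^ i * fact (Suc i) :: complex"
  have nz: "of_real s + z \<noteq> 0" using of_real_add_nonzero[OF assms] .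
  have "((\<lambda>z. (of_real s + z) ^ (i + 2)) has_field_derivative
      of_nat (i + 2) * (of_real s + z) ^ (i + 1)) (at z)"
    by (rule DERIV_cong[OF DERIV_power]) (auto intro!: derivative_eq_intros)
  from DERIV_divide[OF DERIV_const[of ?c] this]
  have "((\<lambda>z. ?c / (of_real s + z) ^ (i + 2)) has_field_derivative
      - (?c * (of_nat (i + 2) * (of_real s + z) ^ (i + 1))) / ((of_real s + z) ^ (i + 2) * (of_real s + z) ^ (i + 2))) (at z)"
    using nz by simp
  also have "- (?c * (of_nat (i + 2) * (of_real s + z) ^ (i + 1))) / ((of_real s + z) ^ (i + 2) * (of_real s + z) ^ (i + 2))
     = of_real s * (-1) ^ Suc i * fact (Suc (Suc i)) / (of_real s + z) ^ (Suc i + 2)"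
  proof -
    have *: "(of_real s + z) ^ (i + 2) * (of_real s + z) ^ (i + 2) =
        (of_real s + z) ^ (i + 1) * (of_real s + z) ^ (Suc i + 2)"
      by (simp only: power_add[symmetric]) simp
    have "- (c * (k * P)) / (P * Q) = - c * k / Q" if "P \<noteq> 0" for c k P Q :: complex
      using that by (simp add: divide_simps)
    from this[of "(of_real s + z) ^ (i + 1)"] show ?thesis
      unfolding * using nz by (simp del: power_Suc add: power_Suc[of "-1"] mult_ac)
  qed
  finally show ?thesis
    by (simp add: Suc pow_kernel_deriv_def[abs_def])
qed

lemma higher_deriv_pow_kernel:
  assumes "Re z > 0" "s > 0"
  shows "(deriv ^^ j) (\<lambda>z. z / (of_real s + z)) z = pow_kernel_deriv j s z"
  using assms(1)
proof (induction j arbitrary: z)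
  case 0
  then show ?case by (simp add: pow_kernel_deriv_def)
next
  case (Suc j)
  \<comment> \<open>The induction hypothesis covers the whole open half-plane, so the formula may be
    differentiated and not merely evaluated at \<open>z\<close>.\<close>
  have "((deriv ^^ j) (\<lambda>z. z / (of_real s + z)) has_field_derivative pow_kernel_deriv (Suc j) s z) (at z)"
    using has_field_derivative_transform_within_open[OF
        pow_kernel_deriv_has_field_derivative[OF Suc.prems assms(2)] open_halfspace_Re_gt[of 0]]
      Suc by auto
  then show ?case
    by (simp add: DERIV_imp_deriv)
qed

text \<open>Joint continuity in the point and the parameter is what differentiation under the
  integral sign requires.\<close>

lemma continuous_on_pow_kernel_deriv:
  assumes "S \<subseteq> {z. Re z > 0} \<times> UNIV"
  shows "continuous_on S (\<lambda>(z, u). of_real (exp (t * u)) * pow_kernel_deriv j (exp u) z)"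
proof -
  have nz: "of_real (exp u) + z \<noteq> 0" if "(z, u) \<in> S" for z u
    using that assms of_real_add_nonzero[of z "exp u"] by auto
  then show ?thesis
    by (cases j) (auto simp: pow_kernel_deriv_def case_prod_beta intro!: continuous_intros)
qed

lemma continuous_on_pow_kernel_deriv_right:
  assumes "Re z > 0"
  shows "continuous_on T (\<lambda>u. of_real (exp (t * u)) * pow_kernel_deriv j (exp u) z)"
proof -
  have "continuous_on ({z} \<times> T) (\<lambda>(z, u). of_real (exp (t * u)) * pow_kernel_deriv j (exp u) z)"
    using assms by (intro continuous_on_pow_kernel_deriv) auto
  from continuous_on_compose2[OF this, of T "\<lambda>u. (z, u)"] show ?thesis
    by (simp add: continuous_on_Pair image_subset_iff)
qed

lemma pow_approx_deriv_step:
  assumes "Re z > 0"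
  shows "((\<lambda>z. integral {-N..N} (\<lambda>u. of_real (exp (t * u)) * pow_kernel_deriv j (exp u) z)) has_field_derivative
     integral {-N..N} (\<lambda>u. of_real (exp (t * u)) * pow_kernel_deriv (Suc j) (exp u) z)) (at z)"
proof -
  let ?U = "{z. Re z > 0}"
  have "((\<lambda>z. integral (cbox (-N) N) (\<lambda>u. of_real (exp (t * u)) * pow_kernel_deriv j (exp u) z)) has_field_derivative
     integral (cbox (-N) N) (\<lambda>u. of_real (exp (t * u)) * pow_kernel_deriv (Suc j) (exp u) z)) (at z within ?U)"
  proof (rule leibniz_rule_field_derivative)
    fix x :: complex and u :: real assume x: "x \<in> ?U"
    show "((\<lambda>x. of_real (exp (t * u)) * pow_kernel_deriv j (exp u) x) has_field_derivative
        of_real (exp (t * u)) * pow_kernel_deriv (Suc j) (exp u) x) (at x within ?U)"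
      using DERIV_cmult[OF pow_kernel_deriv_has_field_derivative[of x "exp u" j]] x
      by (auto intro: has_field_derivative_at_within)
  next
    fix x assume "x \<in> ?U"
    then show "(\<lambda>u. of_real (exp (t * u)) * pow_kernel_deriv j (exp u) x) integrable_on cbox (-N) N"
      by (intro integrable_continuous continuous_on_pow_kernel_deriv_right) auto
  next
    show "continuous_on (?U \<times> cbox (-N) N)
        (\<lambda>(z, u). of_real (exp (t * u)) * pow_kernel_deriv (Suc j) (exp u) z)"
      by (rule continuous_on_pow_kernel_deriv) auto
  qed (use assms convex_halfspace_Re_gt[of 0] in auto)
  then show ?thesis
    using assms by (simp add: at_within_open[OF _ open_halfspace_Re_gt])
qed

lemma higher_deriv_pow_approx:
  assumes "Re z > 0"
  shows "(deriv ^^ j) (pow_approx t N) z =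
     integral {-N..N} (\<lambda>u. of_real (exp (t * u)) * pow_kernel_deriv j (exp u) z)"
  using assms
proof (induction j arbitrary: z)
  case 0
  then show ?case by (simp add: pow_kernel_deriv_def pow_approx_def)
next
  case (Suc j)
  have "((deriv ^^ j) (pow_approx t N) has_field_derivative
      integral {-N..N} (\<lambda>u. of_real (exp (t * u)) * pow_kernel_deriv (Suc j) (exp u) z)) (at z)"
    using has_field_derivative_transform_within_open[OF
        pow_approx_deriv_step[OF Suc.prems] open_halfspace_Re_gt[of 0]] Suc by auto
  then show ?case
    by (simp add: DERIV_imp_deriv)
qed

lemma pow_approx_has_field_derivative:
  assumes "Re z > 0"
  shows "(pow_approx t N has_field_derivative
    integral {-N..N} (\<lambda>u. of_real (exp (t * u)) * pow_kernel_deriv 1 (exp u) z)) (at z)"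
  using pow_approx_deriv_step[OF assms, where j = 0 and t = t and N = N]
  by (simp add: pow_kernel_deriv_def[of 0] pow_approx_def[abs_def])

lemma holomorphic_pow_approx: "pow_approx t N holomorphic_on {z. Re z > 0}"
  using pow_approx_has_field_derivative
  by (auto simp: holomorphic_on_open[OF open_halfspace_Re_gt])

text \<open>The Euler operator turns the defining integral into boundary terms, which vanish as
  \<open>N\<close> grows.\<close>
lemma pow_approx_euler:
  assumes "Re z > 0" "N \<ge> 0"
  shows "z * deriv (pow_approx t N) z - of_real t * pow_approx t N z =
    of_real (exp (- (t * N))) * (z / (of_real (exp (- N)) + z)) - of_real (exp (t * N)) * (z / (of_real (exp N) + z))"
proof -
  define \<theta> where "\<theta> u = of_real (exp (t * u)) * (z / (of_real (exp u) + z))" for u :: real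
  define \<theta>' where "\<theta>' u = of_real (exp (t * u)) * pow_kernel_deriv 1 (exp u) z" for u :: real
  have cont: "continuous_on {-N..N} \<theta>" "continuous_on {-N..N} \<theta>'"
    using continuous_on_pow_kernel_deriv_right[OF assms(1), of _ t 0]
      continuous_on_pow_kernel_deriv_right[OF assms(1), of _ t 1]
    by (auto simp: \<theta>_def \<theta>'_def pow_kernel_deriv_def[of 0])
  \<comment> \<open>The kernel is homogeneous of degree zero in \<open>(exp u, z)\<close>, so its
    derivative in \<open>u\<close> is \<open>- z\<close> times its derivative in \<open>z\<close>;
    the weight contributes the factor \<open>t\<close>.\<close>
  have "(\<theta> has_vector_derivative (of_real t * \<theta> u - z * \<theta>' u)) (at u within {-N..N})" for u
  proof -
    have nz: "of_real (exp u) + z \<noteq> 0" using of_real_add_nonzero[OF assms(1), of "exp u"] by simp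
    have "((\<lambda>w. exp (of_real t * w) * (z / (exp w + z))) has_field_derivative
       of_real t * exp (of_real t * of_real u) * (z / (exp (of_real u) + z)) 
        - z * (exp (of_real t * of_real u) * exp (of_real u) / (exp (of_real u) + z) ^ 2)) (at (of_real u))"
    proof -
      have alg: "(a * b * z * w - a * z * y) / (w * w) = b * a * z / w - z * (a * y) / w\<^sup>2"
        if "w \<noteq> 0" for a b w y :: complex
        using that by (simp add: power2_eq_square divide_simps)
      show ?thesis
        using nz by (auto intro!: derivative_eq_intros simp: exp_of_real alg[OF nz])
    qed
    from has_vector_derivative_real_field[OF this, of "{-N..N}"]
    show ?thesis
      unfolding of_real_mult[symmetric] exp_of_real \<theta>_def[abs_def] \<theta>'_def
      by (simp add: pow_kernel_deriv_def power2_eq_square mult_ac)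
  qed
  then have "((\<lambda>u. of_real t * \<theta> u - z * \<theta>' u) has_integral (\<theta> N - \<theta> (-N))) {-N..N}"
    by (intro fundamental_theorem_of_calculus) (use assms in auto)
  moreover have "((\<lambda>u. of_real t * \<theta> u - z * \<theta>' u) has_integral
      (of_real t * pow_approx t N z - z * deriv (pow_approx t N) z)) {-N..N}"
  proof -
    have "pow_approx t N z = integral {-N..N} \<theta>"
      by (simp add: pow_approx_def \<theta>_def[abs_def])
    moreover have "deriv (pow_approx t N) z = integral {-N..N} \<theta>'"
      using higher_deriv_pow_approx[OF assms(1), of 1 t N] by (simp add: \<theta>'_def[abs_def])
    ultimately show ?thesis using cont
      by (auto intro!: has_integral_diff has_integral_mult_right integrable_integral integrable_continuous_real)
  qed
  ultimately have "of_real t * pow_approx t N z - z * deriv (pow_approx t N) z = \<theta> N - \<theta> (-N)"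
    using has_integral_unique by blast
  then show ?thesis
    by (simp add: \<theta>_def algebra_simps)
qed

lemma norm_ge_add_of_real:
  assumes "Re z > 0" "s \<ge> 0"
  shows "cmod z \<le> cmod (of_real s + z)" "s \<le> cmod (of_real s + z)"
proof -
  have "Re z ^ 2 \<le> (s + Re z) ^ 2"
    using assms by (intro power_mono) auto
  then show "cmod z \<le> cmod (of_real s + z)"
    by (simp add: cmod_def)
  show "s \<le> cmod (of_real s + z)"
    using complex_Re_le_cmod[of "of_real s + z"] assms by simp
qed

text \<open>At \<open>u = -N\<close> the kernel is at most 1 and the weight is
  \<open>exp (- t * N)\<close>; at \<open>u = N\<close> the kernel is at most
  \<open>cmod z / exp N\<close>. Both contributions tend to zero as \<open>N\<close> grows when
  \<open>0 < t < 1\<close>.\<close>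

lemma norm_pow_approx_euler:
  assumes "Re z > 0" "N \<ge> 0"
  shows "cmod (z * deriv (pow_approx t N) z - of_real t * pow_approx t N z)
    \<le> exp (- t * N) + exp (- (1 - t) * N) * cmod z"
proof -
  have z: "z \<noteq> 0" using assms by auto
  have "cmod (z / (of_real (exp (- N)) + z)) \<le> 1"
    using norm_ge_add_of_real(1)[OF assms(1), of "exp (- N)"] z
    by (simp add: norm_divide divide_le_eq_1)
  then have "cmod (of_real (exp (- (t * N))) * (z / (of_real (exp (- N)) + z))) \<le> exp (- t * N)"
    by (simp add: norm_mult mult_left_le del: times_divide_eq_right)
  moreover have "cmod (of_real (exp (t * N)) * (z / (of_real (exp N) + z)))
      \<le> exp (t * N) * (cmod z / exp N)"
    using norm_ge_add_of_real(2)[OF assms(1), of "exp N"]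
    by (auto simp: norm_mult norm_divide intro!: mult_left_mono frac_le)
  moreover have "exp (t * N) * (cmod z / exp N) = exp (- (1 - t) * N) * cmod z"
  proof -
    have "exp (t * N) / exp N = exp (- (1 - t) * N)"
      by (simp add: exp_diff[symmetric] algebra_simps)
    then show ?thesis by (metis times_divide_eq_left times_divide_eq_right)
  qed
  ultimately show ?thesis
    unfolding pow_approx_euler[OF assms]
    by (intro order_trans[OF norm_triangle_ineq4]) linarith
qed

text \<open>On positive reals the approximation is a real integral, which serves as the comparison
  value in the bounds on \<open>hermite_functional\<close>.\<close>

lemma pow_approx_of_real:
  assumes "r > 0"
  shows "pow_approx t N (of_real r) =
      of_real (integral {-N..N} (\<lambda>u. exp (t * u) * (r / (exp u + r))))"
    and "(\<lambda>u. exp (t * u) * (r / (exp u + r))) integrable_on {-N..N}"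
proof -
  have ne: "exp u + r \<noteq> 0" for u using assms exp_gt_zero[of u] by (simp add: add_pos_pos less_imp_neq[symmetric] del: exp_gt_zero)
  show int: "(\<lambda>u. exp (t * u) * (r / (exp u + r))) integrable_on {-N..N}"
    using ne by (intro integrable_continuous_real continuous_intros) auto
  have "((\<lambda>u. complex_of_real (exp (t * u) * (r / (exp u + r)))) has_integral
     of_real (integral {-N..N} (\<lambda>u. exp (t * u) * (r / (exp u + r))))) {-N..N}"
    using int by (intro has_integral_of_real integrable_integral)
  then show "pow_approx t N (of_real r) =
      of_real (integral {-N..N} (\<lambda>u. exp (t * u) * (r / (exp u + r))))"
    unfolding pow_approx_def by (intro integral_unique) simp
qed

lemma pow_approx_1_real: "pow_approx t N 1 = of_real (Re (pow_approx t N 1))"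
  using pow_approx_of_real(1)[of 1] by simp

text \<open>The integrand is positive, so the integral over \<open>{-1..1}\<close>, itself positive
  by compactness, bounds all larger ones from below. This keeps the normalising denominator away
  from zero.\<close>

lemma pow_approx_1_bounded_below: "\<exists>c>0. \<forall>N\<ge>1. c \<le> Re (pow_approx t N 1)"
proof -
  let ?f = "\<lambda>u::real. exp (t * u) * (1 / (exp u + 1))"
  have pos: "exp u + 1 > (0::real)" for u by (simp add: add_pos_pos)
  then have ne: "exp u + 1 \<noteq> (0::real)" for u by (metis less_irrefl)
  have int: "?f integrable_on {-N..N}" for N
    using pow_approx_of_real(2)[of 1] by simp
  have eq: "pow_approx t N 1 = of_real (integral {-N..N} ?f)" for N
    using pow_approx_of_real(1)[of 1] by simp
  define c where "c = integral {-1..1} ?f"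
  have "continuous_on {-1..1} ?f" using ne by (intro continuous_intros) auto
  then have "\<exists>x\<in>{-1..1}. \<forall>y\<in>{-1..1}. ?f x \<le> ?f y"
    by (intro continuous_attains_inf) auto
  then obtain x where x: "\<And>y. y \<in> {-1..1} \<Longrightarrow> ?f x \<le> ?f y" by blast
  have "0 < ?f x" using pos[of x] by simp
  have "integral {-1..1::real} (\<lambda>_. ?f x) \<le> c"
    unfolding c_def using x int[of 1] by (intro integral_le) auto
  then have c: "c > 0" using \<open>0 < ?f x\<close> by simp
  have "c \<le> integral {-N..N} ?f" if "N \<ge> 1" for N
    unfolding c_def using that int[of N] int[of 1] pos
    by (intro integral_subset_le) (auto intro: less_imp_le)
  with c show ?thesis by (auto simp: eq)
qed

text \<open>The Euler defect controls the derivative of \<open>K\<close>, the quotient of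
  \<open>pow_approx\<close> by the power. As the defect vanishes uniformly on the region,
  \<open>K\<close> becomes constant in the limit, and dividing by the value at 1 fixes that constant
  without computing the integral.\<close>

lemma pow_approx_uniform_limit:
  assumes t: "0 < t" "t < 1" and a: "0 < a" "a < 1" and b: "1 < b"
  shows "uniform_limit {z. Re z > a \<and> cmod z < b}
    (\<lambda>N z. pow_approx t N z / pow_approx t N 1) (\<lambda>z. z powr of_real t) at_top"
proof -
  let ?C = "{z. Re z > a \<and> cmod z < b}"
  obtain c where c: "c > 0" "\<And>N. N \<ge> 1 \<Longrightarrow> c \<le> Re (pow_approx t N 1)"
    using pow_approx_1_bounded_below[of t] by blast
  \<comment> \<open>A bound for the derivative of \<open>K N\<close> on the region: \<open>a\<close>
    bounds the modulus of the point from below, \<open>b\<close> from above.\<close>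
  define \<eta> where "\<eta> N = a powr (-t - 1) * (exp (- t * N) + exp (- (1 - t) * N) * b)" for N
  define K where "K N z = z powr (- of_real t) * pow_approx t N z" for N z
  have conv: "convex ?C"
  proof -
    have "?C = {z. Re z > a} \<inter> ball 0 b" by auto
    then show ?thesis by (simp add: convex_Int convex_halfspace_Re_gt)
  qed
  have K_diff: "cmod (K N z - K N 1) \<le> \<eta> N * (b + 1)" if z: "z \<in> ?C" and N: "N \<ge> 0" for N z
  proof -
    \<comment> \<open>The mean value inequality is applied along the segment from 1 to
      \<open>z\<close>, which stays in the convex region.\<close>
    have "cmod (K N z - K N 1) \<le> \<eta> N * cmod (z - 1)"
    proof (rule field_differentiable_bound[OF conv])
      fix w assume w: "w \<in> ?C"
      then have Re: "Re w > 0" "w \<noteq> 0" using a by auto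
      have nonpos: "w \<notin> \<real>\<^sub>\<le>\<^sub>0" using Re complex_nonpos_Reals_iff by auto
      have "(K N has_field_derivative
          - of_real t * w powr (- of_real t - 1) * pow_approx t N w
          + deriv (pow_approx t N) w * w powr (- of_real t)) (at w)"
        unfolding K_def[abs_def]
        using Re by (intro DERIV_mult[OF has_field_derivative_powr[OF nonpos]]
            holomorphic_derivI[OF holomorphic_pow_approx open_halfspace_Re_gt]) auto
      also have "- of_real t * w powr (- of_real t - 1) * pow_approx t N w
          + deriv (pow_approx t N) w * w powr (- of_real t)
        = w powr (- of_real t - 1) * (w * deriv (pow_approx t N) w - of_real t * pow_approx t N w)"
        using Re by (simp add: powr_diff field_simps)
      finally show "(K N has_field_derivative
          w powr (- of_real t - 1) * (w * deriv (pow_approx t N) w - of_real t * pow_approx t N w))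
          (at w within ?C)"
        by (rule has_field_derivative_at_within)
      have "cmod (w powr (- of_real t - 1)) = cmod w powr (- t - 1)"
        using norm_powr_real_powr'[of "of_real (- t - 1)" w] by simp
      also have "\<dots> \<le> a powr (- t - 1)"
        using w a t complex_Re_le_cmod[of w] by (intro powr_mono2') auto
      finally have 1: "cmod (w powr (- of_real t - 1)) \<le> a powr (- t - 1)" .
      have "cmod (w * deriv (pow_approx t N) w - of_real t * pow_approx t N w)
          \<le> exp (- t * N) + exp (- (1 - t) * N) * cmod w"
        by (rule norm_pow_approx_euler[OF Re(1) N])
      also have "\<dots> \<le> exp (- t * N) + exp (- (1 - t) * N) * b"
        using w by (auto intro!: mult_left_mono)
      finally show "cmod (w powr (- of_real t - 1) *
          (w * deriv (pow_approx t N) w - of_real t * pow_approx t N w)) \<le> \<eta> N"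
        unfolding norm_mult \<eta>_def using 1 by (intro mult_mono) auto
    qed (use z a b in auto)
    also have "\<dots> \<le> \<eta> N * (b + 1)"
    proof -
      have "\<eta> N \<ge> 0" unfolding \<eta>_def using b by (intro mult_nonneg_nonneg add_nonneg_nonneg) auto
      moreover have "cmod (z - 1) \<le> b + 1"
        using norm_triangle_ineq4[of z 1] z by simp
      ultimately show ?thesis by (intro mult_left_mono) auto
    qed
    finally show ?thesis .
  qed
  have bound: "dist (pow_approx t N z / pow_approx t N 1) (z powr of_real t)
      \<le> b powr t * (\<eta> N * (b + 1)) / c" if z: "z \<in> ?C" and N: "N \<ge> 1" for N z
  proof -
    have J: "c \<le> cmod (pow_approx t N 1)" "pow_approx t N 1 \<noteq> 0"
      using c(1) c(2)[OF N] complex_Re_le_cmod[of "pow_approx t N 1"] by auto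
    have z0: "z \<noteq> 0" using z a by auto
    \<comment> \<open>Here \<open>K N 1\<close> equals \<open>pow_approx t N 1\<close>, because
      every power of 1 is 1.\<close>
    have "pow_approx t N z / pow_approx t N 1 - z powr of_real t
        = z powr of_real t * (K N z - K N 1) / pow_approx t N 1"
      using J(2) z0 by (simp add: K_def powr_minus field_simps)
    then have "dist (pow_approx t N z / pow_approx t N 1) (z powr of_real t)
        = cmod (z powr of_real t) * cmod (K N z - K N 1) / cmod (pow_approx t N 1)"
      by (simp add: dist_norm norm_mult norm_divide)
    also have "\<dots> \<le> b powr t * (\<eta> N * (b + 1)) / c"
    proof (intro frac_le mult_mono)
      have "cmod (z powr of_real t) = cmod z powr t"
        using norm_powr_real_powr'[of "of_real t" z] by simp
      also have "\<dots> \<le> b powr t" using z t by (intro powr_mono2) auto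
      finally show "cmod (z powr of_real t) \<le> b powr t" .
      show "cmod (K N z - K N 1) \<le> \<eta> N * (b + 1)" using K_diff z N by simp
      then show "0 \<le> b powr t * (\<eta> N * (b + 1))"
        by (meson mult_nonneg_nonneg norm_ge_zero order_trans powr_ge_zero)
    qed (use J c in auto)
    finally show ?thesis .
  qed
  have "((\<lambda>N. b powr t * (\<eta> N * (b + 1)) / c) \<longlongrightarrow> 0) at_top"
  proof -
    have "((\<lambda>N. exp (- t * N)) \<longlongrightarrow> 0) at_top" "((\<lambda>N. exp (- (1 - t) * N)) \<longlongrightarrow> 0) at_top"
      using t by real_asymp+
    then show ?thesis
      unfolding \<eta>_def
      by (intro tendsto_divide_zero tendsto_mult_right_zero tendsto_mult_left_zero tendsto_add_zero)
  qed
  then show ?thesis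
    by (intro uniform_limitI eventually_mono[OF eventually_conj[OF order_tendstoD(2) eventually_ge_at_top[of 1]]])
       (use bound in \<open>fastforce+\<close>)
qed

text \<open>The shape of the map from \<open>f\<close> to the inner product of \<open>f(A) x\<close>
  with \<open>y\<close>: \<open>E\<close> will be the spectrum and \<open>m\<close> the algebraic
  multiplicities, while \<open>c\<close> depends on the matrix and the vectors but not on
  \<open>f\<close>.\<close>

definition hermite_functional ::
    "complex set \<Rightarrow> (complex \<Rightarrow> nat) \<Rightarrow> (complex \<Rightarrow> nat \<Rightarrow> complex) \<Rightarrow> (complex \<Rightarrow> complex) \<Rightarrow> complex" where
  "hermite_functional E m c f = (\<Sum>e\<in>E. \<Sum>j<m e. c e j * (deriv ^^ j) f e)"

text \<open>Locally uniform convergence of holomorphic functions carries over to every derivative,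
  and the functional involves only finitely many of them.\<close>

lemma hermite_functional_pow_approx_tendsto:
  assumes "finite E" and E: "E \<subseteq> {z. Re z > 0}" and t: "0 < t" "t < 1"
  shows "((\<lambda>N. hermite_functional E m c (pow_approx t N) / pow_approx t N 1)
      \<longlongrightarrow> hermite_functional E m c (\<lambda>z. z powr of_real t)) at_top"
proof -
  have lim: "((\<lambda>N. (deriv ^^ j) (pow_approx t N) e / pow_approx t N 1)
      \<longlongrightarrow> (deriv ^^ j) (\<lambda>z. z powr of_real t) e) at_top" if e: "e \<in> E" for e j
  proof -
    \<comment> \<open>The constants make the region contain both \<open>e\<close> and the
      normalisation point 1.\<close>
    define a where "a = min (1/2) (Re e / 2)"
    define b where "b = cmod e + 2"
    have ab: "0 < a" "a < 1" "1 < b" using e E by (auto simp: a_def b_def intro: add_pos_nonneg)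
    let ?C = "{z. Re z > a \<and> cmod z < b}"
    have op: "open ?C"
    proof -
      have "?C = {z. Re z > a} \<inter> ball 0 b" by auto
      then show ?thesis by (simp add: open_Int open_halfspace_Re_gt)
    qed
    have sub: "?C \<subseteq> {z. Re z > 0}" using ab by auto
    have eC: "e \<in> ?C" using e E by (auto simp: a_def b_def min_def field_simps)
    have holo: "pow_approx t N holomorphic_on ?C" for N
      using holomorphic_pow_approx sub by (rule holomorphic_on_subset)
    have "((\<lambda>N. (deriv ^^ j) (\<lambda>z. pow_approx t N z / pow_approx t N 1) e)
      \<longlongrightarrow> (deriv ^^ j) (\<lambda>z. z powr of_real t) e) at_top"
      by (rule higher_deriv_complex_uniform_limit[OF pow_approx_uniform_limit[OF t ab] _ _ op eC])
         (auto simp: divide_inverse intro!: always_eventually holomorphic_intros holo)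
    moreover have "(deriv ^^ j) (\<lambda>z. pow_approx t N z / pow_approx t N 1) e =
        (deriv ^^ j) (pow_approx t N) e / pow_approx t N 1" for N
      using higher_deriv_cmult[OF holo eC op, where c = "1 / pow_approx t N 1" and j=j] by simp
    ultimately show ?thesis by simp
  qed
  show ?thesis
    unfolding hermite_functional_def sum_divide_distrib times_divide_eq_right[symmetric]
    by (intro tendsto_sum tendsto_mult tendsto_const lim) auto
qed

text \<open>Each derivative of the truncated integral is the integral of the differentiated kernel,
  so a finite combination of derivatives passes under the integral.\<close>

lemma hermite_functional_pow_approx:
  assumes "finite E" and E: "E \<subseteq> {z. Re z > 0}"
  shows "((\<lambda>u. of_real (exp (t * u)) * hermite_functional E m c (\<lambda>z. z / (of_real (exp u) + z)))
     has_integral hermite_functional E m c (pow_approx t N)) {-N..N}"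
proof -
  have "((\<lambda>u. \<Sum>e\<in>E. \<Sum>j<m e. c e j * (of_real (exp (t * u)) * pow_kernel_deriv j (exp u) e))
     has_integral (\<Sum>e\<in>E. \<Sum>j<m e. c e j * (deriv ^^ j) (pow_approx t N) e)) {-N..N}"
    using E assms(1)
    by (intro has_integral_sum has_integral_mult_right)
       (auto simp: higher_deriv_pow_approx intro!: integrable_integral integrable_continuous_real
         continuous_on_pow_kernel_deriv_right)
  moreover have "of_real (exp (t * u)) * hermite_functional E m c (\<lambda>z. z / (of_real (exp u) + z)) =
      (\<Sum>e\<in>E. \<Sum>j<m e. c e j * (of_real (exp (t * u)) * pow_kernel_deriv j (exp u) e))" for u
    unfolding hermite_functional_def sum_distrib_left using E
    by (auto intro!: sum.cong simp: higher_deriv_pow_kernel)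
  ultimately show ?thesis
    by (simp add: hermite_functional_def)
qed

lemma pow_approx_ratio_of_real_tendsto:
  assumes t: "0 < t" "t < 1" and r: "r > 0"
  shows "((\<lambda>N. Re (pow_approx t N (of_real r)) / Re (pow_approx t N 1)) \<longlongrightarrow> r powr t) at_top"
proof -
  \<comment> \<open>With one node of multiplicity 1 and coefficient 1 the functional is evaluation
    at \<open>r\<close>.\<close>
  have "((\<lambda>N. pow_approx t N (of_real r) / pow_approx t N 1) \<longlongrightarrow> of_real r powr of_real t) at_top"
    using hermite_functional_pow_approx_tendsto[of "{of_real r}" t "\<lambda>_. 1" "\<lambda>_ _. 1"] t r
    by (simp add: hermite_functional_def)
  from tendsto_Re[OF this] have "((\<lambda>N. Re (pow_approx t N (of_real r) / pow_approx t N 1)) \<longlongrightarrow> r powr t) at_top"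
    using r by (simp add: powr_of_real)
  moreover have "Re (pow_approx t N (of_real r) / pow_approx t N 1) =
      Re (pow_approx t N (of_real r)) / Re (pow_approx t N 1)" for N
    by (metis pow_approx_1_real Re_divide_of_real)
  ultimately show ?thesis by simp
qed

text \<open>Integrating the kernel bound against the positive weight bounds the functional of
  \<open>pow_approx\<close> by the value of \<open>pow_approx\<close> at the scalar
  \<open>r\<close>. Normalising both sides by the value at 1 and letting \<open>N\<close> grow turns
  them into powers.\<close>

lemma hermite_functional_powr_upper:
  assumes E: "finite E" "E \<subseteq> {z. Re z > 0}" and t: "0 < t" "t < 1" and r: "r > 0"
    and bound: "\<And>s. s > 0 \<Longrightarrow> cmod (hermite_functional E m c (\<lambda>z. z / (of_real s + z))) \<le> r / (s + r)"
  shows "cmod (hermite_functional E m c (\<lambda>z. z powr of_real t)) \<le> r powr t"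
proof (rule tendsto_le[OF _ pow_approx_ratio_of_real_tendsto[OF t r]
      tendsto_norm[OF hermite_functional_pow_approx_tendsto[OF E t]]])
  obtain d where d: "d > 0" "\<And>N. N \<ge> 1 \<Longrightarrow> d \<le> Re (pow_approx t N 1)"
    using pow_approx_1_bounded_below[of t] by blast
  have "cmod (hermite_functional E m c (pow_approx t N)) \<le> Re (pow_approx t N (of_real r))" for N
  proof -
    note I = hermite_functional_pow_approx[OF E, of t m c N]
    note J = pow_approx_of_real[OF r, of t N]
    have "cmod (integral {-N..N} (\<lambda>u. of_real (exp (t * u)) * hermite_functional E m c (\<lambda>z. z / (of_real (exp u) + z))))
       \<le> integral {-N..N} (\<lambda>u. exp (t * u) * (r / (exp u + r)))"
      using bound has_integral_integrable[OF I] J(2)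
      by (intro integral_norm_bound_integral) (auto simp: norm_mult simp del: times_divide_eq_right intro!: mult_left_mono)
    then show ?thesis
      unfolding integral_unique[OF I] J(1) by simp
  qed
  moreover have "cmod (pow_approx t N 1) = Re (pow_approx t N 1)" if "N \<ge> 1" for N
    using d(1) d(2)[OF that] pow_approx_1_real[of t N] by (metis abs_of_pos less_le_trans norm_of_real)
  ultimately show "\<forall>\<^sub>F N in at_top. cmod (hermite_functional E m c (pow_approx t N) / pow_approx t N 1)
      \<le> Re (pow_approx t N (of_real r)) / Re (pow_approx t N 1)"
    using d by (intro eventually_mono[OF eventually_ge_at_top[of 1]])
      (auto simp: norm_divide intro!: divide_right_mono order.trans[OF less_imp_le d(2)])
qed auto

text \<open>The same comparison for real parts: taking real parts commutes with the integral, and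
  the positive weight preserves the lower bound.\<close>

lemma hermite_functional_powr_lower:
  assumes E: "finite E" "E \<subseteq> {z. Re z > 0}" and t: "0 < t" "t < 1" and r: "r > 0"
    and bound: "\<And>s. s > 0 \<Longrightarrow> r / (s + r) \<le> Re (hermite_functional E m c (\<lambda>z. z / (of_real s + z)))"
  shows "r powr t \<le> Re (hermite_functional E m c (\<lambda>z. z powr of_real t))"
proof (rule tendsto_le[OF _ tendsto_Re[OF hermite_functional_pow_approx_tendsto[OF E t]]
      pow_approx_ratio_of_real_tendsto[OF t r]])
  obtain d where d: "d > 0" "\<And>N. N \<ge> 1 \<Longrightarrow> d \<le> Re (pow_approx t N 1)"
    using pow_approx_1_bounded_below[of t] by blast
  have "Re (pow_approx t N (of_real r)) \<le> Re (hermite_functional E m c (pow_approx t N))" for N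
  proof -
    have I: "((\<lambda>u. exp (t * u) * Re (hermite_functional E m c (\<lambda>z. z / (of_real (exp u) + z))))
       has_integral Re (hermite_functional E m c (pow_approx t N))) {-N..N}"
      using has_integral_linear[OF hermite_functional_pow_approx[OF E, of t m c N] bounded_linear_Re]
      by (simp add: o_def)
    note J = pow_approx_of_real[OF r, of t N]
    show ?thesis
      unfolding J(1) Re_complex_of_real
      using bound by (intro has_integral_le[OF integrable_integral[OF J(2)] I])
        (auto simp del: times_divide_eq_right intro!: mult_left_mono)
  qed
  moreover have "Re (z / pow_approx t N 1) = Re z / Re (pow_approx t N 1)" for z N
    by (metis pow_approx_1_real Re_divide_of_real)
  ultimately show "\<forall>\<^sub>F N in at_top. Re (pow_approx t N (of_real r)) / Re (pow_approx t N 1) \<le>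
      Re (hermite_functional E m c (pow_approx t N) / pow_approx t N 1)"
    using d by (intro eventually_mono[OF eventually_ge_at_top[of 1]])
      (auto intro!: divide_right_mono order.trans[OF less_imp_le d(2)])
qed auto

section \<open>Hermite interpolation\<close>

lemma higher_deriv_poly:
  fixes p :: "complex poly"
  shows "(deriv ^^ j) (poly p) = poly ((pderiv ^^ j) p)"
proof (induction j)
  case (Suc j)
  have "deriv (poly q) = poly (pderiv q)" for q :: "complex poly"
    by (intro ext DERIV_imp_deriv poly_DERIV)
  then show ?case by (simp add: Suc)
qed simp

lemma pderiv_funpow_add:
  "(pderiv ^^ j) (p + q :: complex poly) = (pderiv ^^ j) p + (pderiv ^^ j) q"
  by (induction j) (auto simp: pderiv_add)

lemma pderiv_funpow_smult:
  "(pderiv ^^ j) (Polynomial.smult c p :: complex poly) = Polynomial.smult c ((pderiv ^^ j) p)"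
  by (induction j) (auto simp: pderiv_smult)

lemma pderiv_funpow_sum:
  "finite I \<Longrightarrow> (pderiv ^^ j) (\<Sum>i\<in>I. f i :: complex poly) = (\<Sum>i\<in>I. (pderiv ^^ j) (f i))"
  by (induction j) (auto simp: pderiv_sum)

lemma pderiv_funpow_diff:
  "(pderiv ^^ j) (p - q :: complex poly) = (pderiv ^^ j) p - (pderiv ^^ j) q"
  by (induction j) (auto simp: pderiv_diff)

text \<open>At a root of a nonzero polynomial, differentiation lowers the multiplicity by exactly
  one, which drives the induction on \<open>k\<close>.\<close>

lemma le_order_iff_higher_pderiv:
  fixes p :: "complex poly"
  assumes "p \<noteq> 0"
  shows "k \<le> order e p \<longleftrightarrow> (\<forall>j<k. poly ((pderiv ^^ j) p) e = 0)"
  using assms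
proof (induction k arbitrary: p)
  case (Suc k)
  show ?case
  proof (cases "poly p e = 0")
    case False
    then show ?thesis
      using order_root[of p e] by auto
  next
    case True
    then have ord: "order e p = Suc (order e (pderiv p))" using Suc.prems by (intro order_pderiv)
    have nz: "pderiv p \<noteq> 0"
    proof
      assume "pderiv p = 0"
      then obtain c where "p = [:c:]" by (metis pderiv_eq_0_iff degree_eq_zeroE)
      then show False using True Suc.prems by simp
    qed
    have "(\<forall>j<Suc k. poly ((pderiv ^^ j) p) e = 0) \<longleftrightarrow> (\<forall>j<k. poly ((pderiv ^^ Suc j) p) e = 0)"
      using True by (metis (no_types, lifting) funpow_0 less_Suc_eq_0_disj)
    also have "\<dots> \<longleftrightarrow> (\<forall>j<k. poly ((pderiv ^^ j) (pderiv p)) e = 0)"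
      by (simp add: funpow_swap1)
    finally show ?thesis
      using Suc.IH[OF nz] ord by simp
  qed
qed simp

lemma order_prod_linear_powers:
  fixes E :: "complex set"
  assumes "finite E" "e \<in> E"
  shows "order e (\<Prod>z\<in>E. [:-z, 1:] ^ m z) = m e"
proof -
  have nz: "[:-z, 1:] ^ m z \<noteq> 0" for z by simp
  have "order e ([:-z, 1:] ^ m z) = (if z = e then m e else 0)" for z
    using order_power_n_n[of e "m e"] by (auto intro!: order_0I)
  then have "(\<Sum>z\<in>E. order e ([:-z, 1:] ^ m z)) = (\<Sum>z\<in>E. if z = e then m e else 0)"
    by (intro sum.cong) auto
  then have sum: "(\<Sum>z\<in>E. order e ([:-z, 1:] ^ m z)) = m e" using assms by (simp add: sum.delta')
  have "order e (\<Prod>z\<in>F. [:-z, 1:] ^ m z) = (\<Sum>z\<in>F. order e ([:-z, 1:] ^ m z))" if "finite F" for F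
    using that
  proof induction
    case (insert x F)
    then have "[:-x, 1:] ^ m x * (\<Prod>z\<in>F. [:-z, 1:] ^ m z) \<noteq> 0" by (auto simp: prod_zero_iff)
    then show ?case using insert by (simp add: order_mult)
  qed simp
  with sum assms show ?thesis by simp
qed

text \<open>Induction on the total number of conditions. Dropping the top condition at one node
  \<open>e0\<close> leaves a solvable problem; its solution is corrected by a multiple of
  \<open>w\<close>, which vanishes to order \<open>m'\<close> at every node and so changes only the
  dropped one among the prescribed values.\<close>

lemma hermite_interpolation:
  fixes d :: "complex \<Rightarrow> nat \<Rightarrow> complex"
  assumes "finite E"
  shows "\<exists>p. \<forall>e\<in>E. \<forall>j<m e. poly ((pderiv ^^ j) p) e = d e j"
proof (induction "\<Sum>e\<in>E. m e" arbitrary: m)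
  case 0
  then show ?case using assms by auto
next
  case (Suc k)
  then obtain e0 where e0: "e0 \<in> E" "m e0 \<noteq> 0"
    by (metis sum.neutral nat.distinct(1))
  define m' where "m' = m(e0 := m e0 - 1)"
  have "(\<Sum>e\<in>E. m e) = m e0 + (\<Sum>e\<in>E - {e0}. m e)" "(\<Sum>e\<in>E. m' e) = m' e0 + (\<Sum>e\<in>E - {e0}. m' e)"
    using assms e0 by (auto intro: sum.remove)
  moreover have "(\<Sum>e\<in>E - {e0}. m' e) = (\<Sum>e\<in>E - {e0}. m e)"
    by (intro sum.cong) (auto simp: m'_def)
  ultimately have "k = (\<Sum>e\<in>E. m' e)" using Suc.hyps(2) e0 by (simp add: m'_def)
  from Suc.hyps(1)[OF this] obtain p where
    p: "\<And>e j. e \<in> E \<Longrightarrow> j < m' e \<Longrightarrow> poly ((pderiv ^^ j) p) e = d e j" by blast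
  define w where "w = (\<Prod>z\<in>E. [:-z, 1:] ^ m' z)"
  have w0: "w \<noteq> 0" using assms by (auto simp: w_def prod_zero_iff)
  have ord: "order e w = m' e" if "e \<in> E" for e
    using order_prod_linear_powers[OF assms that] by (simp add: w_def)
  have w_zero: "poly ((pderiv ^^ j) w) e = 0" if "e \<in> E" "j < m' e" for e j
    using le_order_iff_higher_pderiv[OF w0, of "m' e" e] ord[of e] that by simp
  \<comment> \<open>The order of \<open>w\<close> at \<open>e0\<close> is exactly
    \<open>m' e0\<close>, so its next derivative there is nonzero and can serve as the denominator
    of \<open>c\<close>.\<close>
  have w_nz: "poly ((pderiv ^^ (m' e0)) w) e0 \<noteq> 0"
    using le_order_iff_higher_pderiv[OF w0, of "Suc (m' e0)" e0] ord[of e0] e0 w_zero[of e0]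
    by (auto simp: less_Suc_eq)
  define c where "c = (d e0 (m' e0) - poly ((pderiv ^^ (m' e0)) p) e0) / poly ((pderiv ^^ (m' e0)) w) e0"
  have "poly ((pderiv ^^ j) (p + Polynomial.smult c w)) e = d e j" if "e \<in> E" "j < m e" for e j
  proof (cases "j < m' e")
    case True
    then show ?thesis using p w_zero that by (simp add: pderiv_funpow_add pderiv_funpow_smult)
  next
    case False
    then have "e = e0" "j = m' e0" using that e0 by (auto simp: m'_def split: if_splits)
    then show ?thesis using w_nz by (simp add: pderiv_funpow_add pderiv_funpow_smult c_def)
  qed
  then show ?case by blast
qed

text \<open>Over the complex numbers both polynomials split into linear factors, so divisibility
  reduces to comparing multiplicities root by root.\<close>

lemma dvd_if_higher_derivs_vanish:
  fixes p q :: "complex poly"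
  assumes "q \<noteq> 0"
    and "\<And>e j. poly q e = 0 \<Longrightarrow> j < order e q \<Longrightarrow> poly ((pderiv ^^ j) p) e = 0"
  shows "q dvd p"
proof (cases "p = 0")
  case False
  let ?Z = "\<lambda>p. {z. poly p z = 0}"
  have le: "order z q \<le> order z p" if "poly q z = 0" for z
    using le_order_iff_higher_pderiv[OF False, of "order z q" z] assms(2)[OF that] by blast
  have "(\<Prod>z\<in>?Z q. [:-z, 1:] ^ order z q) dvd (\<Prod>z\<in>?Z p. [:-z, 1:] ^ order z p)"
  proof (rule prod_dvd_prod_subset2)
    show "?Z q \<subseteq> ?Z p"
    proof safe
      fix z assume "poly q z = 0"
      then have "order z p \<noteq> 0" using le[of z] assms(1) order_root[of q z] by auto
      then show "poly p z = 0" using order_root[of p z] by auto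
    qed
    show "[:-z, 1:] ^ order z q dvd [:-z, 1:] ^ order z p" if "z \<in> ?Z q" for z
      using that le by (intro le_imp_power_dvd) auto
    show "finite (?Z p)" using False by (rule poly_roots_finite)
  qed
  also have "\<dots> dvd Polynomial.smult (lead_coeff p) (\<Prod>z\<in>?Z p. [:-z, 1:] ^ order z p)"
    by (intro dvd_smult dvd_refl)
  also have "\<dots> = p" by (rule complex_poly_decompose)
  finally have "Polynomial.smult (lead_coeff q) (\<Prod>z\<in>?Z q. [:-z, 1:] ^ order z q) dvd p"
    using assms(1) by (intro smult_dvd) auto
  then show ?thesis by (simp only: complex_poly_decompose)
qed simp

section \<open>Polynomials in a matrix\<close>

lemma mat_poly_eval_0: "mat_poly_eval 0 A = 0\<^sub>m (dim_row A) (dim_row A)"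
  by (simp add: mat_poly_eval_def)

lemma mat_poly_eval_carrier:
  assumes "A \<in> carrier_mat n n"
  shows "mat_poly_eval p A \<in> carrier_mat n n"
proof -
  have "foldr (\<lambda>c M. c \<cdot>\<^sub>m 1\<^sub>m (dim_row A) + A * M) cs (0\<^sub>m (dim_row A) (dim_row A)) \<in> carrier_mat n n" for cs
    using assms by (induction cs) auto
  then show ?thesis by (simp add: mat_poly_eval_def)
qed

lemma mat_poly_eval_pCons:
  assumes "A \<in> carrier_mat n n"
  shows "mat_poly_eval (pCons c p) A = c \<cdot>\<^sub>m 1\<^sub>m n + A * mat_poly_eval p A"
\<comment> \<open>The zero polynomial has an empty coefficient list, so prepending a zero
  coefficient to it adds no step to the fold; every other case adds exactly one.\<close>
proof (cases "p = 0 \<and> c = 0")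
  case True
  then show ?thesis
    using assms by (auto simp: mat_poly_eval_0 intro!: eq_matI)
next
  case False
  then show ?thesis
    using assms by (auto simp: mat_poly_eval_def cCons_def)
qed

lemma mat_poly_eval_add:
  assumes A: "A \<in> carrier_mat n n"
  shows "mat_poly_eval (p + q) A = mat_poly_eval p A + mat_poly_eval q A"
proof (induction p q rule: poly_induct2)
  case 0
  then show ?case using A by (auto simp: mat_poly_eval_0)
next
  case (pCons a p b q)
  note c = mat_poly_eval_carrier[OF A]
  show ?case
    unfolding add_pCons mat_poly_eval_pCons[OF A] pCons.IH
      mult_add_distrib_mat[OF A c c]
    by (rule eq_matI) (use A c[of p] c[of q] in \<open>auto simp: algebra_simps\<close>)
qed

lemma mat_poly_eval_smult:
  assumes A: "A \<in> carrier_mat n n"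
  shows "mat_poly_eval (Polynomial.smult a p) A = a \<cdot>\<^sub>m mat_poly_eval p A"
proof (induction p)
  case 0
  then show ?case using A by (auto simp: mat_poly_eval_0)
next
  case (pCons b p)
  note c = mat_poly_eval_carrier[OF A]
  show ?case
    unfolding smult_pCons mat_poly_eval_pCons[OF A] pCons.IH mult_smult_distrib[OF A c]
    by (rule eq_matI) (use A c[of p] in \<open>auto simp: algebra_simps\<close>)
qed

lemma mat_poly_eval_mult:
  assumes A: "A \<in> carrier_mat n n"
  shows "mat_poly_eval (p * q) A = mat_poly_eval p A * mat_poly_eval q A"
proof (induction p)
  case 0
  then show ?case using mat_poly_eval_carrier[OF A, of q] A by (auto simp: mat_poly_eval_0)
next
  case (pCons a p)
  note c = mat_poly_eval_carrier[OF A]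
  have "mat_poly_eval (pCons a p * q) A =
      a \<cdot>\<^sub>m mat_poly_eval q A + (0 \<cdot>\<^sub>m 1\<^sub>m n + A * (mat_poly_eval p A * mat_poly_eval q A))"
    by (simp add: mat_poly_eval_add[OF A] mat_poly_eval_smult[OF A] mat_poly_eval_pCons[OF A] pCons.IH)
  also have "\<dots> = a \<cdot>\<^sub>m mat_poly_eval q A + A * (mat_poly_eval p A * mat_poly_eval q A)"
    by (rule eq_matI) (use A c[of p] c[of q] in auto)
  also have "\<dots> = (a \<cdot>\<^sub>m 1\<^sub>m n + A * mat_poly_eval p A) * mat_poly_eval q A"
    using add_mult_distrib_mat[of "a \<cdot>\<^sub>m 1\<^sub>m n" n n "A * mat_poly_eval p A" "mat_poly_eval q A" n]
      assoc_mult_mat[OF A c c] mult_smult_assoc_mat[of "1\<^sub>m n" n n "mat_poly_eval q A" n a]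
      A c[of p] c[of q] by auto
  finally show ?case
    by (simp add: mat_poly_eval_pCons[OF A])
qed

lemma mat_poly_eval_const:
  assumes A: "A \<in> carrier_mat n n"
  shows "mat_poly_eval [:c:] A = c \<cdot>\<^sub>m 1\<^sub>m n"
  by (rule eq_matI) (use A in \<open>auto simp: mat_poly_eval_pCons[OF A] mat_poly_eval_0\<close>)

lemma mat_poly_eval_X:
  assumes A: "A \<in> carrier_mat n n"
  shows "mat_poly_eval [:0, 1:] A = A"
proof -
  have "mat_poly_eval [:0, 1:] A = 0 \<cdot>\<^sub>m 1\<^sub>m n + A * (1 \<cdot>\<^sub>m 1\<^sub>m n)"
    using mat_poly_eval_pCons[OF A, of 0 "[:1:]"] mat_poly_eval_const[OF A, of 1] by simp
  also have "A * (1 \<cdot>\<^sub>m 1\<^sub>m n) = A"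
    using A by (auto simp: mult_smult_distrib[OF A one_carrier_mat] intro!: eq_matI)
  finally show ?thesis
    by (simp, intro eq_matI) (use A in auto)
qed

text \<open>Column \<open>j\<close> of \<open>z I - A\<close> acts as zero on the standard basis when \<open>z\<close> acts as \<open>A\<close>;
  multiplying by the adjugate turns it into the characteristic polynomial.\<close>
lemma cayley_hamilton:
  assumes A: "A \<in> carrier_mat n n"
  shows "mat_poly_eval (char_poly A) A = 0\<^sub>m n n"
proof (rule eq_matI)
  \<comment> \<open>Each matrix entry is a linear functional of the polynomial; through these
    functionals the polynomial entries of the characteristic matrix are evaluated at
    \<open>A\<close>.\<close>
  define a where "a p l i = mat_poly_eval p A $$ (l, i)" for p l i
  note c = mat_poly_eval_carrier[OF A]
  have a_mult: "a (p * q) l i = (\<Sum>m<n. a p l m * a q m i)" if "l < n" "i < n" for p q l i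
    using that c[of p] c[of q] unfolding a_def mat_poly_eval_mult[OF A]
    by (auto simp: scalar_prod_def lessThan_atLeast0)
  have a_add: "a (p + q) l i = a p l i + a q l i" if "l < n" "i < n" for p q l i
    using that c[of p] c[of q] unfolding a_def mat_poly_eval_add[OF A] by auto
  have a_0: "a 0 l i = 0" if "l < n" "i < n" for l i
    using that A by (simp add: a_def mat_poly_eval_0)
  have a_sum: "a (\<Sum>j\<in>J. f j) l i = (\<Sum>j\<in>J. a (f j) l i)" if "l < n" "i < n" for J l i and f :: "nat \<Rightarrow> complex poly"
    using sum_comp_morphism[of "\<lambda>p. a p l i" f J] a_add[OF that] a_0[OF that] by (simp add: o_def)
  define M where "M = char_poly_matrix A"
  have M: "M \<in> carrier_mat n n" using A by (simp add: M_def)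
  have M_a: "a (M $$ (i, j)) m i = (if i = j then A $$ (m, i) else 0) - (if m = i then A $$ (i, j) else 0)"
    if "i < n" "j < n" "m < n" for i j m
  proof -
    have "M $$ (i, j) = (if i = j then [:0, 1:] else 0) + [:- A $$ (i, j):]"
      using that A by (simp add: M_def char_poly_matrix_def)
    then show ?thesis
      using that A a_add[of m i] a_0[of m i]
      by (auto simp: a_def mat_poly_eval_const[OF A] mat_poly_eval_X[OF A])
  qed
  define D where "D = adj_mat M"
  have D: "D \<in> carrier_mat n n" "M * D = det M \<cdot>\<^sub>m 1\<^sub>m n"
    using adj_mat[OF M] by (auto simp: D_def)
  fix l k assume lk: "l < dim_row (0\<^sub>m n n :: complex mat)" "k < dim_col (0\<^sub>m n n :: complex mat)"
  then have l: "l < n" and k: "k < n" by auto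
  \<comment> \<open>Writing the characteristic polynomial with a Kronecker delta in \<open>i\<close>
    prepares for replacing it by the entry \<open>(i, k)\<close> of \<open>M * D\<close>.\<close>
  have "a (char_poly A) l k = (\<Sum>i<n. a (if i = k then char_poly A else 0) l i)"
  proof -
    have "(\<Sum>i<n. a (if i = k then char_poly A else 0) l i) = (\<Sum>i<n. if i = k then a (char_poly A) l i else 0)"
      using a_0 l by (intro sum.cong) auto
    then show ?thesis using k by simp
  qed
  also have "\<dots> = (\<Sum>i<n. a (\<Sum>j<n. D $$ (j, k) * M $$ (i, j)) l i)"
  proof (intro sum.cong refl)
    fix i assume "i \<in> {..<n}"
    then have i: "i < n" by simp
    have "(\<Sum>j<n. D $$ (j, k) * M $$ (i, j)) = (M * D) $$ (i, k)"
      using i k M D(1) by (auto simp: scalar_prod_def lessThan_atLeast0 mult.commute intro!: sum.cong)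
    also have "\<dots> = (if i = k then char_poly A else 0)"
      unfolding D(2) using i k by (simp add: char_poly_def M_def)
    finally show "a (if i = k then char_poly A else 0) l i = a (\<Sum>j<n. D $$ (j, k) * M $$ (i, j)) l i"
      by simp
  qed
  also have "\<dots> = (\<Sum>i<n. \<Sum>j<n. \<Sum>m<n. a (D $$ (j, k)) l m * a (M $$ (i, j)) m i)"
    using l by (intro sum.cong refl) (simp add: a_sum a_mult)
  also have "\<dots> = (\<Sum>j<n. \<Sum>i<n. \<Sum>m<n. a (D $$ (j, k)) l m * a (M $$ (i, j)) m i)"
    by (rule sum.swap)
  also have "\<dots> = (\<Sum>j<n. \<Sum>m<n. a (D $$ (j, k)) l m * (\<Sum>i<n. a (M $$ (i, j)) m i))"
    unfolding sum_distrib_left by (intro sum.cong refl sum.swap)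
  \<comment> \<open>For fixed \<open>j\<close> and \<open>m\<close>, the two Kronecker deltas in
    \<open>M_a\<close> each select the entry \<open>A $$ (m, j)\<close>, with opposite
    signs.\<close>
  also have "\<dots> = 0"
  proof (intro sum.neutral ballI)
    fix j m assume "j \<in> {..<n}" "m \<in> {..<n}"
    then have "(\<Sum>i<n. a (M $$ (i, j)) m i) =
       (\<Sum>i<n. (if i = j then A $$ (m, i) else 0) - (if m = i then A $$ (i, j) else 0))"
      by (intro sum.cong) (auto simp: M_a)
    also have "\<dots> = 0"
      using \<open>j \<in> {..<n}\<close> \<open>m \<in> {..<n}\<close> by (simp add: sum_subtractf)
    finally show "a (D $$ (j, k)) l m * (\<Sum>i<n. a (M $$ (i, j)) m i) = 0" by simp
  qed
  finally show "mat_poly_eval (char_poly A) A $$ (l, k) = 0\<^sub>m n n $$ (l, k)"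
    using l k by (simp add: a_def)
qed (use mat_poly_eval_carrier[OF A] in auto)


text \<open>The condition inside \<open>principal_pow\<close>, freed from the power function so that
  resolvent kernels can be evaluated at \<open>A\<close> in the same way.\<close>

definition interpolates :: "complex mat \<Rightarrow> (complex \<Rightarrow> complex) \<Rightarrow> complex poly \<Rightarrow> bool" where
  "interpolates A f p \<longleftrightarrow> (\<forall>e. poly (char_poly A) e = 0 \<longrightarrow>
     (\<forall>j<order e (char_poly A). (deriv ^^ j) (poly p) e = (deriv ^^ j) f e))"

section \<open>Matrix functions as functionals of derivatives on the spectrum\<close>

lemma char_poly_nonzero:
  assumes "A \<in> carrier_mat n n"
  shows "char_poly (A :: complex mat) \<noteq> 0"
  using degree_monic_char_poly[OF assms] by auto

lemma interpolates_exists: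
  assumes "A \<in> carrier_mat n n"
  obtains p where "interpolates A f p"
proof -
  have "finite {e. poly (char_poly A) e = 0}"
    using char_poly_nonzero[OF assms] by (rule poly_roots_finite)
  from hermite_interpolation[OF this, of "\<lambda>e. order e (char_poly A)" "\<lambda>e j. (deriv ^^ j) f e"] that
  show ?thesis by (auto simp: interpolates_def higher_deriv_poly)
qed

lemma mat_poly_eval_eq_0:
  assumes A: "A \<in> carrier_mat n n"
    and "\<And>e j. poly (char_poly A) e = 0 \<Longrightarrow> j < order e (char_poly A) \<Longrightarrow> (deriv ^^ j) (poly p) e = 0"
  shows "mat_poly_eval p A = 0\<^sub>m n n"
proof -
  have "char_poly A dvd p"
    using assms(2) char_poly_nonzero[OF A]
    by (intro dvd_if_higher_derivs_vanish) (auto simp: higher_deriv_poly)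
  then obtain k where "p = char_poly A * k" by (rule dvdE)
  then show ?thesis
    using mat_poly_eval_carrier[OF A, of k] by (simp add: mat_poly_eval_mult[OF A] cayley_hamilton[OF A])
qed

text \<open>Two polynomials with the same data differ by a multiple of the characteristic
  polynomial, which Cayley-Hamilton annihilates. This is the uniqueness behind the
  \<open>THE\<close> in \<open>principal_pow\<close>.\<close>

lemma mat_poly_eval_eqI:
  assumes A: "A \<in> carrier_mat n n"
    and "\<And>e j. poly (char_poly A) e = 0 \<Longrightarrow> j < order e (char_poly A) \<Longrightarrow>
      (deriv ^^ j) (poly p) e = (deriv ^^ j) (poly q) e"
  shows "mat_poly_eval p A = mat_poly_eval q A"
proof -
  note c = mat_poly_eval_carrier[OF A]
  have "mat_poly_eval (p - q) A = 0\<^sub>m n n"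
    using assms(2) by (intro mat_poly_eval_eq_0[OF A]) (auto simp: higher_deriv_poly pderiv_funpow_diff)
  moreover have "mat_poly_eval p A = mat_poly_eval (p - q) A + mat_poly_eval q A"
    using mat_poly_eval_add[OF A, of "p - q" q] by simp
  ultimately show ?thesis using c[of q] by simp
qed

lemma principal_pow_eq:
  assumes A: "A \<in> carrier_mat n n" and p: "interpolates A (\<lambda>z. z powr of_real t) p"
  shows "principal_pow t A = mat_poly_eval p A"
  unfolding principal_pow_def interpolates_def[symmetric]
proof (rule the_equality)
  fix B assume "\<exists>p. interpolates A (\<lambda>z. z powr of_real t) p \<and> B = mat_poly_eval p A"
  then obtain q where "interpolates A (\<lambda>z. z powr of_real t) q" "B = mat_poly_eval q A" by blast
  then show "B = mat_poly_eval p A"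
    using p by (auto simp: interpolates_def intro!: mat_poly_eval_eqI[OF A])
qed (use p in auto)

lemma principal_pow_carrier:
  assumes "A \<in> carrier_mat n n"
  shows "principal_pow t A \<in> carrier_mat n n"
  by (metis assms interpolates_exists principal_pow_eq mat_poly_eval_carrier)

text \<open>The polynomials \<open>H e j\<close> are dual to the derivative values, so any
  interpolant of \<open>f\<close> acts at \<open>A\<close> like their combination with weights
  \<open>(deriv ^^ j) f e\<close>. The coefficients are chosen before \<open>f\<close>, so one
  choice serves the power and all resolvent kernels.\<close>

lemma hermite_functional_exists:
  assumes A: "A \<in> carrier_mat n n" and x: "x \<in> carrier_vec n" and y: "y \<in> carrier_vec n"
  shows "\<exists>c. \<forall>f p. interpolates A f p \<longrightarrow> (mat_poly_eval p A *\<^sub>v x) \<bullet>c y =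
    hermite_functional {e. poly (char_poly A) e = 0} (\<lambda>e. order e (char_poly A)) c f"
proof -
  let ?E = "{e. poly (char_poly A) e = 0}" and ?m = "\<lambda>e. order e (char_poly A)"
  note carr = mat_poly_eval_carrier[OF A]
  have fin: "finite ?E" using char_poly_nonzero[OF A] by (rule poly_roots_finite)
  define \<Phi> where "\<Phi> p = (mat_poly_eval p A *\<^sub>v x) \<bullet>c y" for p
  have \<Phi>_add: "\<Phi> (p + q) = \<Phi> p + \<Phi> q" for p q
    using carr[of p] carr[of q] x y
    by (simp add: \<Phi>_def mat_poly_eval_add[OF A] add_mult_distrib_mat_vec[of _ n n] add_scalar_prod_distrib[of _ n])
  have \<Phi>_smult: "\<Phi> (Polynomial.smult a p) = a * \<Phi> p" for a p
  proof -
    have "(a \<cdot>\<^sub>m mat_poly_eval p A) *\<^sub>v x = a \<cdot>\<^sub>v (mat_poly_eval p A *\<^sub>v x)"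
      using carr[of p] x by (intro eq_vecI) (auto simp: smult_scalar_prod_distrib[of _ n])
    then show ?thesis
      using carr[of p] x y by (simp add: \<Phi>_def mat_poly_eval_smult[OF A] smult_scalar_prod_distrib[of _ n])
  qed
  have \<Phi>_0: "\<Phi> 0 = 0" using \<Phi>_smult[of 0 0] by simp
  have \<Phi>_sum: "\<Phi> (sum f J) = (\<Sum>j\<in>J. \<Phi> (f j))" for f :: "'i \<Rightarrow> complex poly" and J
    using sum_comp_morphism[of \<Phi> f J] \<Phi>_add \<Phi>_0 by (simp add: o_def)
  let ?is_basis = "\<lambda>e0 j0 h. \<forall>e\<in>?E. \<forall>j<?m e. poly ((pderiv ^^ j) h) e = (if e = e0 \<and> j = j0 then 1 else 0)"
  define H where "H e0 j0 = (SOME h. ?is_basis e0 j0 h)" for e0 j0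
  have "?is_basis e0 j0 (H e0 j0)" for e0 j0
    unfolding H_def by (rule someI_ex) (rule hermite_interpolation[OF fin])
  then have H: "poly ((pderiv ^^ j) (H e0 j0)) e = (if e = e0 \<and> j = j0 then 1 else 0)"
    if "e \<in> ?E" "j < ?m e" for e0 j0 e j
    using that by blast
  have "\<Phi> p = hermite_functional ?E ?m (\<lambda>e j. \<Phi> (H e j)) f" if p: "interpolates A f p" for f p
  proof -
    define P where "P = (\<Sum>e\<in>?E. \<Sum>j<?m e. Polynomial.smult ((deriv ^^ j) f e) (H e j))"
    have "(deriv ^^ i) (poly p) w = (deriv ^^ i) (poly P) w" if "w \<in> ?E" "i < ?m w" for i w
    proof -
      have "(deriv ^^ i) (poly P) w =
          (\<Sum>e\<in>?E. \<Sum>j<?m e. (deriv ^^ j) f e * (if w = e \<and> i = j then 1 else 0))"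
        using fin that by (simp add: higher_deriv_poly P_def pderiv_funpow_sum pderiv_funpow_smult poly_sum H)
      also have "\<dots> = (\<Sum>e\<in>?E. if w = e then (\<Sum>j<?m e. if i = j then (deriv ^^ j) f e else 0) else 0)"
        by (intro sum.cong) (auto simp: mult_delta_right)
      also have "\<dots> = (deriv ^^ i) f w"
        using fin that by simp
      finally show ?thesis using p that by (simp add: interpolates_def)
    qed
    then have "mat_poly_eval p A = mat_poly_eval P A"
      by (intro mat_poly_eval_eqI[OF A]) auto
    then have "\<Phi> p = \<Phi> P" by (simp add: \<Phi>_def)
    also have "\<dots> = hermite_functional ?E ?m (\<lambda>e j. \<Phi> (H e j)) f"
      by (simp add: P_def \<Phi>_sum \<Phi>_smult hermite_functional_def mult.commute)
    finally show ?thesis .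
  qed
  then show ?thesis by (auto simp: \<Phi>_def)
qed

text \<open>Every term of the Leibniz expansion contains a derivative of \<open>g\<close> of order
  at most \<open>j\<close>.\<close>

lemma higher_deriv_mult_eq_0:
  assumes "f holomorphic_on S" "g holomorphic_on S" "open S" "z \<in> S"
    and "\<And>i. i \<le> j \<Longrightarrow> (deriv ^^ i) g z = 0"
  shows "(deriv ^^ j) (\<lambda>w. f w * g w) z = 0"
  using assms(5) by (simp add: higher_deriv_mult[OF assms(1-4)])

text \<open>The inverse of \<open>s + A\<close> is \<open>p(A)\<close> for an interpolant
  \<open>p\<close> of \<open>1 / (s + z)\<close>. The error \<open>g\<close> vanishes to the
  required order on the spectrum, and this survives multiplication by \<open>s + z\<close> and by
  \<open>z\<close>; the first product yields the inverse, the second the value of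
  \<open>z / (s + z)\<close> at \<open>A\<close>. The pole \<open>-s\<close> lies outside the
  half-plane that contains the spectrum.\<close>

lemma resolvent_eval:
  assumes A: "A \<in> carrier_mat n n" and roots: "\<And>e. poly (char_poly A) e = 0 \<Longrightarrow> Re e > 0"
    and s: "s > 0"
  obtains Q where "Q \<in> carrier_mat n n" "(of_real s \<cdot>\<^sub>m 1\<^sub>m n + A) * Q = 1\<^sub>m n"
    "\<exists>p. interpolates A (\<lambda>z. z / (of_real s + z)) p \<and> mat_poly_eval p A = A * Q"
proof -
  let ?U = "{z::complex. Re z > 0}"
  obtain p where p: "interpolates A (\<lambda>z. 1 / (of_real s + z)) p"
    by (rule interpolates_exists[OF A])
  define g where "g z = poly p z - 1 / (of_real s + z)" for z
  have nz: "of_real s + z \<noteq> 0" if "z \<in> ?U" for z using that s by (intro of_real_add_nonzero) auto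
  have holo_poly: "poly q holomorphic_on ?U" for q
    by (intro holomorphic_intros)
  have holo: "(\<lambda>z. 1 / (of_real s + z)) holomorphic_on ?U" "(\<lambda>z. z / (of_real s + z)) holomorphic_on ?U"
    using nz by (auto intro!: holomorphic_intros)
  have g: "g holomorphic_on ?U"
    unfolding g_def[abs_def] by (intro holomorphic_intros holo)
  note U = open_halfspace_Re_gt[of 0]
  have vanish: "(deriv ^^ j) (\<lambda>w. h w * g w) e = 0"
    if "h holomorphic_on ?U" "poly (char_poly A) e = 0" "j < order e (char_poly A)" for h e j
  proof (rule higher_deriv_mult_eq_0[OF that(1) g U])
    show "e \<in> ?U" using roots that by simp
    fix i assume "i \<le> j"
    then show "(deriv ^^ i) g e = 0"
      using p that higher_deriv_diff[OF holo_poly holo(1) U \<open>e \<in> ?U\<close>, of i p]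
      by (simp add: interpolates_def g_def[abs_def])
  qed
  show ?thesis
  proof
    show Q: "mat_poly_eval p A \<in> carrier_mat n n" by (rule mat_poly_eval_carrier[OF A])
    have "mat_poly_eval ([:of_real s, 1:] * p) A = mat_poly_eval [:1:] A"
    proof (rule mat_poly_eval_eqI[OF A])
      fix e j assume e: "poly (char_poly A) e = 0" "j < order e (char_poly A)"
      have "(deriv ^^ j) (poly ([:of_real s, 1:] * p - [:1:])) e = (deriv ^^ j) (\<lambda>z. (of_real s + z) * g z) e"
      proof (rule higher_deriv_transform_within_open[OF holo_poly _ U])
        show "(\<lambda>z. (of_real s + z) * g z) holomorphic_on ?U" by (intro holomorphic_intros g)
        show "poly ([:of_real s, 1:] * p - [:1:]) z = (of_real s + z) * g z" if "z \<in> ?U" for z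
          using nz[OF that] by (simp add: g_def algebra_simps)
      qed (use roots[OF e(1)] in auto)
      also have "\<dots> = 0" by (intro vanish e holomorphic_intros)
      finally show "(deriv ^^ j) (poly ([:of_real s, 1:] * p)) e = (deriv ^^ j) (poly [:1:]) e"
        unfolding higher_deriv_poly pderiv_funpow_diff by simp
    qed
    moreover have "mat_poly_eval [:of_real s, 1:] A = of_real s \<cdot>\<^sub>m 1\<^sub>m n + A"
      using mat_poly_eval_pCons[OF A, of "of_real s" "[:1:]"] mat_poly_eval_const[OF A, of 1] A
      by (auto simp: mult_smult_distrib[OF A one_carrier_mat] intro!: eq_matI)
    ultimately show "(of_real s \<cdot>\<^sub>m 1\<^sub>m n + A) * mat_poly_eval p A = 1\<^sub>m n"
      using mat_poly_eval_const[OF A, of 1] unfolding mat_poly_eval_mult[OF A]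
      by (auto intro!: eq_matI)
    have "interpolates A (\<lambda>z. z / (of_real s + z)) ([:0, 1:] * p)"
      unfolding interpolates_def
    proof (intro allI impI)
      fix e j assume e: "poly (char_poly A) e = 0" "j < order e (char_poly A)"
      have eU: "e \<in> ?U" using roots e by simp
      have "(deriv ^^ j) (poly ([:0, 1:] * p)) e - (deriv ^^ j) (\<lambda>z. z / (of_real s + z)) e
          = (deriv ^^ j) (\<lambda>z. poly ([:0, 1:] * p) z - z / (of_real s + z)) e"
        by (rule higher_deriv_diff[OF holo_poly holo(2) U eU, symmetric])
      also have "(\<lambda>z. poly ([:0, 1:] * p) z - z / (of_real s + z)) = (\<lambda>z. z * g z)"
        by (auto simp: g_def algebra_simps)
      also have "(deriv ^^ j) (\<lambda>z. z * g z) e = 0" by (intro vanish e holomorphic_intros)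
      finally show "(deriv ^^ j) (poly ([:0, 1:] * p)) e = (deriv ^^ j) (\<lambda>z. z / (of_real s + z)) e"
        by (simp only: right_minus_eq)
    qed
    moreover have "mat_poly_eval ([:0, 1:] * p) A = A * mat_poly_eval p A"
      by (simp only: mat_poly_eval_mult[OF A] mat_poly_eval_X[OF A])
    ultimately show "\<exists>q. interpolates A (\<lambda>z. z / (of_real s + z)) q \<and> mat_poly_eval q A = A * mat_poly_eval p A"
      by blast
  qed
qed

section \<open>Sectorial forms\<close>

lemma cscalar_prod_sum:
  assumes "x \<in> carrier_vec n" "y \<in> carrier_vec n"
  shows "x \<bullet>c y = (\<Sum>i<n. x $ i * cnj (y $ i))"
  using assms by (auto simp: scalar_prod_def lessThan_atLeast0)

lemma cscalar_prod_swap: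
  assumes "x \<in> carrier_vec n" "y \<in> carrier_vec n"
  shows "y \<bullet>c x = cnj (x \<bullet>c y)"
  using assms by (simp add: cscalar_prod_sum mult.commute)

lemma cscalar_prod_self:
  assumes "x \<in> carrier_vec n"
  shows "x \<bullet>c x = of_real (\<Sum>i<n. (cmod (x $ i))\<^sup>2)"
  using assms by (simp add: cscalar_prod_sum complex_norm_square del: of_real_power)

lemma cscalar_prod_self_Re:
  assumes "x \<in> carrier_vec n"
  shows "Re (x \<bullet>c x) = (\<Sum>i<n. (cmod (x $ i))\<^sup>2)" "x \<bullet>c x = of_real (Re (x \<bullet>c x))" "Re (x \<bullet>c x) \<ge> 0"
  unfolding cscalar_prod_self[OF assms] by (simp_all add: sum_nonneg)

lemma cscalar_prod_cauchy_schwarz: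
  assumes "x \<in> carrier_vec n" "y \<in> carrier_vec n"
  shows "cmod (x \<bullet>c y) \<le> sqrt (Re (x \<bullet>c x)) * sqrt (Re (y \<bullet>c y))"
proof -
  have "cmod (x \<bullet>c y) \<le> (\<Sum>i<n. \<bar>cmod (x $ i)\<bar> * \<bar>cmod (y $ i)\<bar>)"
    unfolding cscalar_prod_sum[OF assms] by (rule order_trans[OF norm_sum]) (simp add: norm_mult)
  also have "\<dots> \<le> L2_set (\<lambda>i. cmod (x $ i)) {..<n} * L2_set (\<lambda>i. cmod (y $ i)) {..<n}"
    by (rule L2_set_mult_ineq)
  finally show ?thesis
    using assms by (simp add: L2_set_def cscalar_prod_self_Re(1))
qed

lemma cscalar_prod_bilinear:
  assumes "a \<in> carrier_vec n" "b \<in> carrier_vec n" "u \<in> carrier_vec n" "v \<in> carrier_vec n"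
  shows "(a + c \<cdot>\<^sub>v b) \<bullet>c (u + d \<cdot>\<^sub>v v) = a \<bullet>c u + cnj d * (a \<bullet>c v) + c * (b \<bullet>c u) + c * cnj d * (b \<bullet>c v)"
proof -
  have "(a + c \<cdot>\<^sub>v b) \<bullet>c (u + d \<cdot>\<^sub>v v) = (\<Sum>i<n. (a + c \<cdot>\<^sub>v b) $ i * cnj ((u + d \<cdot>\<^sub>v v) $ i))"
    using assms by (intro cscalar_prod_sum) auto
  also have "\<dots> = (\<Sum>i<n. (a $ i + c * b $ i) * cnj (u $ i + d * v $ i))"
    using assms by (intro sum.cong) auto
  finally show ?thesis
    using assms by (simp add: cscalar_prod_sum[of _ n] algebra_simps sum.distrib sum_distrib_left)
qed

lemma cscalar_prod_smult:
  assumes "u \<in> carrier_vec n" "v \<in> carrier_vec n"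
  shows "(c \<cdot>\<^sub>v u) \<bullet>c v = c * (u \<bullet>c v)" "u \<bullet>c (c \<cdot>\<^sub>v v) = cnj c * (u \<bullet>c v)"
proof -
  have 1: "(c \<cdot>\<^sub>v u) \<bullet>c v = c * (u \<bullet>c v)"
    if "u \<in> carrier_vec n" "v \<in> carrier_vec n" for c u v
    using that by (simp add: smult_scalar_prod_distrib[of _ n])
  show "(c \<cdot>\<^sub>v u) \<bullet>c v = c * (u \<bullet>c v)" using 1 assms .
  show "u \<bullet>c (c \<cdot>\<^sub>v v) = cnj c * (u \<bullet>c v)"
    using cscalar_prod_swap[of "c \<cdot>\<^sub>v v" n u] cscalar_prod_swap[of v n u] assms 1[of v u c] by simp
qed

lemma quadratic_form_expand:
  assumes A: "A \<in> carrier_mat n n" and uv: "u \<in> carrier_vec n" "v \<in> carrier_vec n"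
  shows "(A *\<^sub>v (u + c \<cdot>\<^sub>v v)) \<bullet>c (u + c \<cdot>\<^sub>v v) = (A *\<^sub>v u) \<bullet>c u + cnj c * ((A *\<^sub>v u) \<bullet>c v)
    + c * ((A *\<^sub>v v) \<bullet>c u) + of_real ((cmod c)\<^sup>2) * ((A *\<^sub>v v) \<bullet>c v)"
proof -
  have "A *\<^sub>v (u + c \<cdot>\<^sub>v v) = A *\<^sub>v u + c \<cdot>\<^sub>v (A *\<^sub>v v)"
    using assms by (simp add: mult_add_distrib_mat_vec mult_mat_vec)
  moreover have "A *\<^sub>v u \<in> carrier_vec n" "A *\<^sub>v v \<in> carrier_vec n" using assms by auto
  ultimately show ?thesis
    using uv unfolding complex_norm_square by (simp add: cscalar_prod_bilinear)
qed

lemma quadratic_form_smult: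
  assumes A: "A \<in> carrier_mat n n" and v: "v \<in> carrier_vec n"
  shows "(A *\<^sub>v (c \<cdot>\<^sub>v v)) \<bullet>c (c \<cdot>\<^sub>v v) = of_real ((cmod c)\<^sup>2) * ((A *\<^sub>v v) \<bullet>c v)"
proof -
  have "A *\<^sub>v v \<in> carrier_vec n" using assms by auto
  then show ?thesis
    using v unfolding complex_norm_square
    by (simp add: mult_mat_vec[OF assms] cscalar_prod_smult[of _ n] smult_carrier_vec)
qed

lemma cscalar_prod_expand:
  assumes "u \<in> carrier_vec n" "v \<in> carrier_vec n"
  shows "(u + c \<cdot>\<^sub>v v) \<bullet>c (u + c \<cdot>\<^sub>v v) = u \<bullet>c u + cnj c * (u \<bullet>c v) + c * (v \<bullet>c u)
    + of_real ((cmod c)\<^sup>2) * (v \<bullet>c v)"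
  using quadratic_form_expand[OF one_carrier_mat[of n] assms, of c] assms by simp

lemma cscalar_prod_smult_self:
  assumes "v \<in> carrier_vec n"
  shows "(c \<cdot>\<^sub>v v) \<bullet>c (c \<cdot>\<^sub>v v) = of_real ((cmod c)\<^sup>2) * (v \<bullet>c v)"
  using quadratic_form_smult[OF one_carrier_mat[of n] assms, of c] assms by simp

lemma cscalar_prod_self_pos:
  assumes "x \<in> carrier_vec n" "x \<noteq> 0\<^sub>v n"
  shows "Re (x \<bullet>c x) > 0"
proof -
  obtain i where i: "i < n" "x $ i \<noteq> 0"
    using assms by (metis eq_vecI carrier_vecD index_zero_vec)
  have "0 < (cmod (x $ i))\<^sup>2" using i by simp
  also have "\<dots> \<le> (\<Sum>i<n. (cmod (x $ i))\<^sup>2)"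
    using i by (intro member_le_sum) auto
  finally show ?thesis using assms by (simp add: cscalar_prod_self_Re(1))
qed

lemma normalize_vec:
  assumes "x \<in> carrier_vec n" "x \<noteq> 0\<^sub>v n"
  obtains u c where "u \<in> carrier_vec n" "u \<bullet>c u = 1" "c > 0" "x = of_real c \<cdot>\<^sub>v u" "c\<^sup>2 = Re (x \<bullet>c x)"
proof
  define c where "c = sqrt (Re (x \<bullet>c x))"
  have c: "c > 0" "c\<^sup>2 = Re (x \<bullet>c x)" using cscalar_prod_self_pos[OF assms] by (auto simp: c_def)
  show "of_real (1 / c) \<cdot>\<^sub>v x \<in> carrier_vec n" using assms by simp
  show "(of_real (1 / c) \<cdot>\<^sub>v x) \<bullet>c (of_real (1 / c) \<cdot>\<^sub>v x) = 1"
  proof -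
    have "(cmod (of_real (1 / c)))\<^sup>2 * c\<^sup>2 = 1"
      using c(1) by (simp add: norm_divide power_divide)
    moreover have "x \<bullet>c x = of_real (c\<^sup>2)"
      using cscalar_prod_self_Re(2)[OF assms(1)] c(2) by simp
    ultimately show ?thesis
      unfolding cscalar_prod_smult_self[OF assms(1)] by (metis of_real_1 of_real_mult)
  qed
  show "c > 0" "c\<^sup>2 = Re (x \<bullet>c x)" by (fact c)+
  show "x = of_real c \<cdot>\<^sub>v (of_real (1 / c) \<cdot>\<^sub>v x)"
    using c by (simp add: smult_smult_assoc flip: of_real_mult)
qed

text \<open>Multiplying \<open>F\<close> by the conjugate of its phase \<open>sgn F\<close> gives
  its modulus.\<close>

lemma sup_over_phases:
  assumes "\<And>c. cmod c = 1 \<Longrightarrow> Re (cnj c * F) \<le> X"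
  shows "cmod F \<le> X"
proof (cases "F = 0")
  case True
  then show ?thesis using assms[of 1] by simp
next
  case False
  then have "cnj (sgn F) * F = of_real (cmod F)"
    by (simp add: sgn_eq complex_norm_square[symmetric] power2_eq_square divide_simps mult.commute[of _ F])
  then show ?thesis using assms[of "sgn F"] False by (simp add: norm_sgn)
qed

text \<open>Both \<open>k Re a - Im a\<close> and \<open>k Re a + Im a\<close> are positive semidefinite hermitian forms, and the
  off-diagonal entry \<open>auv\<close> is a combination of theirs with coefficients \<open>(1 / k \<plusminus> \<i>) / 2\<close>.\<close>
lemma sectorial_off_diagonal_pos:
  fixes k :: real and auu auv avu avv :: complex
  assumes k: "k > 0"
    and sect: "\<And>c. cmod c = 1 \<Longrightarrow>
      \<bar>Im (auu - cnj c * auv - c * avu + avv)\<bar> \<le> k * Re (auu - cnj c * auv - c * avu + avv)"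
  shows "cmod auv \<le> sqrt (1 + k\<^sup>2) / 2 * (Re auu + Re avv)"
proof -
  \<comment> \<open>\<open>F\<close> and \<open>G\<close> are twice the off-diagonal entries of
    \<open>k Re a - Im a\<close> and \<open>k Re a + Im a\<close>. Testing the sector condition at
    all phases bounds each modulus by the sum of the diagonal entries of its form.\<close>
  define F where "F = (of_real k * (auv + cnj avu) + \<i> * (auv - cnj avu))"
  define G where "G = (of_real k * (auv + cnj avu) - \<i> * (auv - cnj avu))"
  have F: "cmod F \<le> k * Re (auu + avv) - Im (auu + avv)"
  proof (rule sup_over_phases)
    fix c :: complex assume "cmod c = 1"
    from abs_le_D1[OF sect[OF this]] show "Re (cnj c * F) \<le> k * Re (auu + avv) - Im (auu + avv)"
      by (simp add: F_def algebra_simps)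
  qed
  have G: "cmod G \<le> k * Re (auu + avv) + Im (auu + avv)"
  proof (rule sup_over_phases)
    fix c :: complex assume "cmod c = 1"
    from abs_le_D2[OF sect[OF this]] show "Re (cnj c * G) \<le> k * Re (auu + avv) + Im (auu + avv)"
      by (simp add: G_def algebra_simps)
  qed
  have eq: "4 * of_real k * auv = F * (1 - \<i> * of_real k) + G * (1 + \<i> * of_real k)"
    by (simp add: F_def G_def algebra_simps)
  have nrm: "cmod (1 - \<i> * of_real k) = sqrt (1 + k\<^sup>2)" "cmod (1 + \<i> * of_real k) = sqrt (1 + k\<^sup>2)"
    by (simp_all add: cmod_def)
  have "4 * k * cmod auv = cmod (4 * of_real k * auv)"
    using k by (simp add: norm_mult)
  also have "\<dots> \<le> cmod F * sqrt (1 + k\<^sup>2) + cmod G * sqrt (1 + k\<^sup>2)"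
    unfolding eq using norm_triangle_ineq[of "F * (1 - \<i> * of_real k)" "G * (1 + \<i> * of_real k)"]
    by (simp add: norm_mult nrm)
  also have "\<dots> = (cmod F + cmod G) * sqrt (1 + k\<^sup>2)" by (simp add: algebra_simps)
  \<comment> \<open>The imaginary parts cancel when the two bounds are added.\<close>
  also have "\<dots> \<le> (2 * k * (Re auu + Re avv)) * sqrt (1 + k\<^sup>2)"
    using F G by (intro mult_right_mono) (auto simp: algebra_simps)
  finally have "k * (4 * cmod auv) \<le> k * (2 * (Re auu + Re avv) * sqrt (1 + k\<^sup>2))"
    by (simp add: algebra_simps)
  then have "4 * cmod auv \<le> 2 * (Re auu + Re avv) * sqrt (1 + k\<^sup>2)"
    using k by (simp only: mult_le_cancel_left_pos)
  then show ?thesis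
    by (simp add: algebra_simps)
qed

text \<open>The case \<open>k = 0\<close>, where division by \<open>k\<close> fails, is reached as a
  limit from the right: since the real part is nonnegative, the sector condition persists for every
  larger slope.\<close>

lemma sectorial_off_diagonal:
  fixes k :: real and auu auv avu avv :: complex
  assumes k: "k \<ge> 0"
    and sect: "\<And>c. cmod c = 1 \<Longrightarrow>
      \<bar>Im (auu - cnj c * auv - c * avu + avv)\<bar> \<le> k * Re (auu - cnj c * auv - c * avu + avv)
      \<and> Re (auu - cnj c * auv - c * avu + avv) \<ge> 0"
  shows "cmod auv \<le> sqrt (1 + k\<^sup>2) / 2 * (Re auu + Re avv)"
proof (rule tendsto_lowerbound)
  show "((\<lambda>k. sqrt (1 + k\<^sup>2) / 2 * (Re auu + Re avv)) \<longlongrightarrow> sqrt (1 + k\<^sup>2) / 2 * (Re auu + Re avv)) (at_right k)"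
    by (intro tendsto_intros) auto
  show "\<forall>\<^sub>F k' in at_right k. cmod auv \<le> sqrt (1 + k'\<^sup>2) / 2 * (Re auu + Re avv)"
  proof (rule eventually_mono[OF eventually_at_right_less])
    fix k' assume k': "k < k'"
    show "cmod auv \<le> sqrt (1 + k'\<^sup>2) / 2 * (Re auu + Re avv)"
    proof (rule sectorial_off_diagonal_pos)
      show "k' > 0" using k k' by simp
      fix c :: complex assume c: "cmod c = 1"
      have "k * Re (auu - cnj c * auv - c * avu + avv) \<le> k' * Re (auu - cnj c * auv - c * avu + avv)"
        using sect[OF c] k' by (intro mult_right_mono) auto
      then show "\<bar>Im (auu - cnj c * auv - c * avu + avv)\<bar> \<le> k' * Re (auu - cnj c * auv - c * avu + avv)"
        using sect[OF c] by linarith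
    qed
  qed
qed simp

text \<open>Unit vectors are encoded as functions supported below \<open>n\<close>, so that the
  product topology applies: the sphere is a closed subset of a product of discs and points, which is
  compact by Tychonoff.\<close>

lemma compact_coordinate_sphere:
  "compact {f :: nat \<Rightarrow> complex. (\<forall>i\<ge>n. f i = 0) \<and> (\<Sum>i<n. (cmod (f i))\<^sup>2) = 1}" (is "compact ?S")
proof -
  let ?K = "PiE UNIV (\<lambda>i. if i < n then cball 0 1 else {0}) :: (nat \<Rightarrow> complex) set"
  have "compact ?K"
    using compactin_PiE[of "\<lambda>_. euclidean" UNIV "\<lambda>i. if i < n then cball 0 1 else {0 :: complex}"]
    by (simp add: euclidean_product_topology)
  moreover have "closed {f :: nat \<Rightarrow> complex. (\<Sum>i<n. (cmod (f i))\<^sup>2) = 1}"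
    by (intro closed_Collect_eq continuous_intros continuous_on_product_coordinates)
  moreover have "?S = ?K \<inter> {f. (\<Sum>i<n. (cmod (f i))\<^sup>2) = 1}"
  proof (intro Set.set_eqI iffI)
    fix f assume f: "f \<in> ?S"
    have "cmod (f i) \<le> 1" if "i < n" for i
    proof -
      have "(cmod (f i))\<^sup>2 \<le> (\<Sum>i<n. (cmod (f i))\<^sup>2)"
        using that by (intro member_le_sum) auto
      then show ?thesis using f by (simp add: abs_square_le_1)
    qed
    then show "f \<in> ?K \<inter> {f. (\<Sum>i<n. (cmod (f i))\<^sup>2) = 1}" using f by (auto simp: PiE_iff)
  next
    fix f assume f: "f \<in> ?K \<inter> {f. (\<Sum>i<n. (cmod (f i))\<^sup>2) = 1}"
    then have "f i \<in> (if i < n then cball 0 1 else {0})" for i by (auto simp: PiE_iff)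
    then have "f i = 0" if "i \<ge> n" for i using that by (metis not_le singletonD)
    then show "f \<in> ?S" using f by auto
  qed
  ultimately show ?thesis by (simp add: compact_Int_closed)
qed

lemma quadratic_form_sum:
  assumes "A \<in> carrier_mat n n" "x \<in> carrier_vec n" "y \<in> carrier_vec n"
  shows "(A *\<^sub>v x) \<bullet>c y = (\<Sum>i<n. (\<Sum>j<n. A $$ (i, j) * x $ j) * cnj (y $ i))"
proof -
  have "A *\<^sub>v x \<in> carrier_vec n" using assms by auto
  then have "(A *\<^sub>v x) \<bullet>c y = (\<Sum>i<n. (A *\<^sub>v x) $ i * cnj (y $ i))"
    using assms by (intro cscalar_prod_sum)
  also have "\<dots> = (\<Sum>i<n. (\<Sum>j<n. A $$ (i, j) * x $ j) * cnj (y $ i))"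
    using assms by (intro sum.cong refl) (auto simp: scalar_prod_def lessThan_atLeast0)
  finally show ?thesis .
qed

lemma quadratic_form_maximizer:
  assumes A: "A \<in> carrier_mat n n" and n: "n > 0"
  obtains x where "x \<in> carrier_vec n" "x \<bullet>c x = 1"
    "\<And>y. y \<in> carrier_vec n \<Longrightarrow> y \<bullet>c y = 1 \<Longrightarrow> Re ((A *\<^sub>v y) \<bullet>c y) \<le> Re ((A *\<^sub>v x) \<bullet>c x)"
proof -
  let ?S = "{f :: nat \<Rightarrow> complex. (\<forall>i\<ge>n. f i = 0) \<and> (\<Sum>i<n. (cmod (f i))\<^sup>2) = 1}"
  define g where "g f = Re (\<Sum>i<n. (\<Sum>j<n. A $$ (i, j) * f j) * cnj (f i))" for f :: "nat \<Rightarrow> complex"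
  have cont: "continuous_on ?S g"
    unfolding g_def[abs_def]
    by (intro continuous_intros continuous_on_product_then_coordinatewise[OF continuous_on_id])
  \<comment> \<open>The first basis vector, available because \<open>n > 0\<close>, shows that the
    sphere is nonempty.\<close>
  have "(\<Sum>i<n. (cmod (if i = 0 then 1 else 0))\<^sup>2) = 1"
  proof -
    have "(\<Sum>i<n. (cmod (if i = 0 then 1 else 0))\<^sup>2) = (\<Sum>i<n. if i = 0 then 1 else 0 :: real)"
      by (intro sum.cong) auto
    then show ?thesis using n by simp
  qed
  then have "(\<lambda>i. if i = 0 then 1 else 0) \<in> ?S" using n by auto
  then have "?S \<noteq> {}" by (metis empty_iff)
  from continuous_attains_sup[OF compact_coordinate_sphere this cont]
  obtain f where f: "f \<in> ?S" "\<forall>h\<in>?S. g h \<le> g f" by (rule bexE)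
  have g_vec: "Re ((A *\<^sub>v y) \<bullet>c y) = g (\<lambda>i. if i < n then y $ i else 0)" if "y \<in> carrier_vec n" for y
    using that by (simp add: quadratic_form_sum[OF A] g_def)
  show ?thesis
  proof
    show x: "vec n f \<in> carrier_vec n" by simp
    show "vec n f \<bullet>c vec n f = 1"
      unfolding cscalar_prod_self[OF x] using f(1) by simp
    have eq: "(\<lambda>i. if i < n then vec n f $ i else 0) = f" using f(1) by auto
    fix y :: "complex vec" assume y: "y \<in> carrier_vec n" "y \<bullet>c y = 1"
    then have "(\<lambda>i. if i < n then y $ i else 0) \<in> ?S"
      using cscalar_prod_self_Re(1)[OF y(1)] by simp
    from bspec[OF f(2) this] show "Re ((A *\<^sub>v y) \<bullet>c y) \<le> Re ((A *\<^sub>v vec n f) \<bullet>c vec n f)"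
      unfolding g_vec[OF y(1)] g_vec[OF x] eq .
  qed
qed

lemma Pi_s_sector:
  assumes "A \<in> Pi_s n \<alpha>" "x \<in> carrier_vec n" "x \<noteq> 0\<^sub>v n"
  shows "Re ((A *\<^sub>v x) \<bullet>c x) > 0" "\<bar>Im ((A *\<^sub>v x) \<bullet>c x)\<bar> \<le> tan \<alpha> * Re ((A *\<^sub>v x) \<bullet>c x)"
proof -
  have A: "A \<in> carrier_mat n n" using assms(1) by (simp add: Pi_s_def)
  obtain u c where u: "u \<in> carrier_vec n" "u \<bullet>c u = 1" and c: "c > 0" and x: "x = of_real c \<cdot>\<^sub>v u"
    using normalize_vec[OF assms(2,3)] by metis
  have "(A *\<^sub>v u) \<bullet>c u \<in> num_range A"
    using u A by (auto simp: num_range_def)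
  then have "(A *\<^sub>v u) \<bullet>c u \<in> sector \<alpha>" using assms(1) by (auto simp: Pi_s_def)
  then have s: "Re ((A *\<^sub>v u) \<bullet>c u) > 0" "\<bar>Im ((A *\<^sub>v u) \<bullet>c u)\<bar> \<le> tan \<alpha> * Re ((A *\<^sub>v u) \<bullet>c u)"
    by (auto simp: sector_def)
  have "(A *\<^sub>v x) \<bullet>c x = of_real (c\<^sup>2) * ((A *\<^sub>v u) \<bullet>c u)"
    unfolding x quadratic_form_smult[OF A u(1)] using c by simp
  then have eq: "Re ((A *\<^sub>v x) \<bullet>c x) = c\<^sup>2 * Re ((A *\<^sub>v u) \<bullet>c u)" "Im ((A *\<^sub>v x) \<bullet>c x) = c\<^sup>2 * Im ((A *\<^sub>v u) \<bullet>c u)"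
    by (simp_all del: of_real_power)
  show "Re ((A *\<^sub>v x) \<bullet>c x) > 0" using s c by (simp add: eq)
  have "c\<^sup>2 * \<bar>Im ((A *\<^sub>v u) \<bullet>c u)\<bar> \<le> c\<^sup>2 * (tan \<alpha> * Re ((A *\<^sub>v u) \<bullet>c u))"
    using s by (intro mult_left_mono) auto
  then show "\<bar>Im ((A *\<^sub>v x) \<bullet>c x)\<bar> \<le> tan \<alpha> * Re ((A *\<^sub>v x) \<bullet>c x)"
    by (simp add: eq abs_mult algebra_simps)
qed

text \<open>The sector has slope \<open>k = tan \<alpha>\<close>, for which
  \<open>sqrt (1 + k^2)\<close> is \<open>1 / cos \<alpha>\<close>. The sector condition is tested
  on \<open>u - c v\<close> for every phase \<open>c\<close>.\<close>

lemma Pi_s_form_bound: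
  assumes \<alpha>: "0 \<le> \<alpha>" "\<alpha> < pi / 2" and A: "A \<in> Pi_s n \<alpha>"
    and u: "u \<in> carrier_vec n" and v: "v \<in> carrier_vec n"
  shows "cmod ((A *\<^sub>v u) \<bullet>c v) \<le> (Re ((A *\<^sub>v u) \<bullet>c u) + Re ((A *\<^sub>v v) \<bullet>c v)) / (2 * cos \<alpha>)"
proof -
  have carr: "A \<in> carrier_mat n n" using A by (simp add: Pi_s_def)
  have cos: "cos \<alpha> > 0" using \<alpha> by (intro cos_gt_zero_pi) auto
  have "sqrt (1 + (tan \<alpha>)\<^sup>2) = 1 / cos \<alpha>"
  proof -
    have "1 + (tan \<alpha>)\<^sup>2 = (1 / cos \<alpha>)\<^sup>2"
      using cos sin_cos_squared_add[of \<alpha>] by (simp add: tan_def field_simps)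
    then show ?thesis using cos by (simp add: real_sqrt_abs)
  qed
  moreover have "cmod ((A *\<^sub>v u) \<bullet>c v) \<le> sqrt (1 + (tan \<alpha>)\<^sup>2) / 2 * (Re ((A *\<^sub>v u) \<bullet>c u) + Re ((A *\<^sub>v v) \<bullet>c v))"
  proof (rule sectorial_off_diagonal)
    show "0 \<le> tan \<alpha>" using \<alpha> by (cases "\<alpha> = 0") (auto intro!: less_imp_le tan_gt_zero)
    fix c :: complex assume c: "cmod c = 1"
    let ?w = "u + (- c) \<cdot>\<^sub>v v"
    have w: "?w \<in> carrier_vec n" using u v by simp
    have "\<bar>Im ((A *\<^sub>v ?w) \<bullet>c ?w)\<bar> \<le> tan \<alpha> * Re ((A *\<^sub>v ?w) \<bullet>c ?w) \<and> 0 \<le> Re ((A *\<^sub>v ?w) \<bullet>c ?w)"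
    \<comment> \<open>The combination may vanish; \<open>Pi_s_sector\<close> does not cover that
      case, but the form is then zero.\<close>
    proof (cases "?w = 0\<^sub>v n")
      case True
      have "A *\<^sub>v 0\<^sub>v n \<in> carrier_vec n" using carr by auto
      then have "(A *\<^sub>v ?w) \<bullet>c ?w = 0" unfolding True by (simp add: cscalar_prod_sum[of _ n])
      then show ?thesis by simp
    next
      case False
      then show ?thesis using Pi_s_sector[OF A w] by (auto intro: less_imp_le)
    qed
    then show "\<bar>Im ((A *\<^sub>v u) \<bullet>c u - cnj c * ((A *\<^sub>v u) \<bullet>c v) - c * ((A *\<^sub>v v) \<bullet>c u) + (A *\<^sub>v v) \<bullet>c v)\<bar>
       \<le> tan \<alpha> * Re ((A *\<^sub>v u) \<bullet>c u - cnj c * ((A *\<^sub>v u) \<bullet>c v) - c * ((A *\<^sub>v v) \<bullet>c u) + (A *\<^sub>v v) \<bullet>c v)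
      \<and> 0 \<le> Re ((A *\<^sub>v u) \<bullet>c u - cnj c * ((A *\<^sub>v u) \<bullet>c v) - c * ((A *\<^sub>v v) \<bullet>c u) + (A *\<^sub>v v) \<bullet>c v)"
      unfolding quadratic_form_expand[OF carr u v] using c by simp
  qed
  ultimately show ?thesis by (simp add: field_simps)
qed

lemma quadratic_form_le_max:
  assumes A: "A \<in> carrier_mat n n"
    and max: "\<And>y. y \<in> carrier_vec n \<Longrightarrow> y \<bullet>c y = 1 \<Longrightarrow> Re ((A *\<^sub>v y) \<bullet>c y) \<le> r"
    and v: "v \<in> carrier_vec n"
  shows "Re ((A *\<^sub>v v) \<bullet>c v) \<le> r * Re (v \<bullet>c v)"
proof (cases "v = 0\<^sub>v n")
  case True
  have "A *\<^sub>v 0\<^sub>v n \<in> carrier_vec n" using A by auto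
  then show ?thesis unfolding True by (simp add: cscalar_prod_sum[of _ n])
next
  case False
  obtain u c where u: "u \<in> carrier_vec n" "u \<bullet>c u = 1" and c: "c > 0" "c\<^sup>2 = Re (v \<bullet>c v)"
    and eq: "v = of_real c \<cdot>\<^sub>v u"
    using normalize_vec[OF v False] by metis
  have "(A *\<^sub>v v) \<bullet>c v = of_real (c\<^sup>2) * ((A *\<^sub>v u) \<bullet>c u)"
    unfolding eq quadratic_form_smult[OF A u(1)] using c by simp
  then have "Re ((A *\<^sub>v v) \<bullet>c v) = c\<^sup>2 * Re ((A *\<^sub>v u) \<bullet>c u)" by (simp del: of_real_power)
  also have "\<dots> \<le> c\<^sup>2 * r" using max[OF u] by (intro mult_left_mono) auto
  finally show ?thesis unfolding c(2) by (simp add: mult.commute)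
qed

text \<open>A maximizer of the quadratic form is an eigenvector of the hermitian part.\<close>
lemma quadratic_form_maximizer_eigen:
  assumes A: "A \<in> carrier_mat n n" and x: "x \<in> carrier_vec n" "x \<bullet>c x = 1"
    and max: "\<And>v. v \<in> carrier_vec n \<Longrightarrow> Re ((A *\<^sub>v v) \<bullet>c v) \<le> r * Re (v \<bullet>c v)"
    and r: "Re ((A *\<^sub>v x) \<bullet>c x) = r" and v: "v \<in> carrier_vec n"
  shows "Re ((A *\<^sub>v x) \<bullet>c v) + Re ((A *\<^sub>v v) \<bullet>c x) = 2 * r * Re (x \<bullet>c v)"
proof -
  define b where "b = Re ((A *\<^sub>v x) \<bullet>c v) + Re ((A *\<^sub>v v) \<bullet>c x) - 2 * r * Re (x \<bullet>c v)"
  define d where "d = r * Re (v \<bullet>c v) - Re ((A *\<^sub>v v) \<bullet>c v)"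
  \<comment> \<open>First variation: \<open>d\<close> collects the second order terms. The
    inequality holds for both signs of the increment, which forces the linear coefficient
    \<open>b\<close> to vanish.\<close>
  have key: "\<epsilon> * b \<le> \<epsilon>\<^sup>2 * d" for \<epsilon> :: real
  proof -
    have w: "x + of_real \<epsilon> \<cdot>\<^sub>v v \<in> carrier_vec n" using x v by simp
    have "Re (v \<bullet>c x) = Re (x \<bullet>c v)" using cscalar_prod_swap[OF x(1) v] by simp
    then show ?thesis
      using max[OF w] x(2) r
      unfolding quadratic_form_expand[OF A x(1) v] cscalar_prod_expand[OF x(1) v]
      by (simp add: b_def d_def algebra_simps)
  qed
  have "d \<ge> 0" using max[OF v] by (simp add: d_def)
  \<comment> \<open>With this increment \<open>key\<close> reads
    \<open>e^2 (d + 1) <= e^2 d\<close>; adding 1 keeps the denominator positive.\<close>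
  define e where "e = b / (d + 1)"
  have be: "b = e * (d + 1)" using \<open>d \<ge> 0\<close> by (simp add: e_def)
  have "e\<^sup>2 \<le> 0" using key[of e] by (simp add: be power2_eq_square algebra_simps)
  then have "b = 0" by (simp add: be)
  then show ?thesis by (simp add: b_def)
qed

text \<open>Here \<open>w\<close> stands for \<open>A u\<close> with \<open>(s + A) u = x\<close>.
  In the expansion of the squared norm of \<open>x\<close>, the hypothesis bounds the cross term
  \<open>P\<close> below by \<open>W / m\<close>; combined with the nonnegative squared norm of
  \<open>w - m u\<close> it also gives \<open>U >= W / m^2\<close>. Equality holds when
  \<open>A\<close> is the scalar \<open>m\<close>.\<close>

lemma cocoercive_resolvent_bound:
  assumes Au: "w \<in> carrier_vec n" and u: "u \<in> carrier_vec n" and m: "m > 0" and s: "s > 0"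
    and coco: "Re (w \<bullet>c w) \<le> m * Re (w \<bullet>c u)"
    and x: "of_real s \<cdot>\<^sub>v u + w = x"
  shows "Re (w \<bullet>c w) \<le> (m / (s + m))\<^sup>2 * Re (x \<bullet>c x)"
proof -
  define W U P where "W = Re (w \<bullet>c w)" and "U = Re (u \<bullet>c u)" and "P = Re (w \<bullet>c u)"
  have swap: "Re (u \<bullet>c w) = P" using cscalar_prod_swap[OF Au u] by (simp add: P_def)
  have X: "Re (x \<bullet>c x) = s\<^sup>2 * U + 2 * s * P + W"
  proof -
    have "x = w + of_real s \<cdot>\<^sub>v u" using x Au u by (metis comm_add_vec smult_carrier_vec)
    then show ?thesis
      using swap by (simp add: cscalar_prod_expand[OF Au u] W_def U_def P_def algebra_simps)
  qed
  have "0 \<le> Re ((w + of_real (- m) \<cdot>\<^sub>v u) \<bullet>c (w + of_real (- m) \<cdot>\<^sub>v u))"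
    using Au u by (intro cscalar_prod_self_Re(3)[of _ n]) simp
  then have "0 \<le> W - 2 * m * P + m\<^sup>2 * U"
    unfolding cscalar_prod_expand[OF Au u] using swap by (simp add: W_def U_def P_def algebra_simps)
  then have mU: "W \<le> m\<^sup>2 * U" using coco by (simp add: W_def P_def)
  have "(s + m)\<^sup>2 * W = s\<^sup>2 * W + 2 * s * m * W + m\<^sup>2 * W"
    by (simp add: power2_eq_square algebra_simps)
  also have "\<dots> \<le> s\<^sup>2 * (m\<^sup>2 * U) + 2 * s * m * (m * P) + m\<^sup>2 * W"
    using mU coco s m by (intro add_mono mult_left_mono order_refl) (auto simp: W_def P_def)
  also have "\<dots> = m\<^sup>2 * Re (x \<bullet>c x)"
    by (simp add: X power2_eq_square algebra_simps)
  finally have "(s + m)\<^sup>2 * W \<le> m\<^sup>2 * Re (x \<bullet>c x)" .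
  then show ?thesis
    using s m by (simp add: W_def power_divide field_simps)
qed

text \<open>Testing the accretive form of \<open>s + A\<close> on \<open>u - rho x\<close>, where
  \<open>rho = Re <u, x>\<close>, gives \<open>rho <= 1 / (s + r)\<close>. Since
  \<open>A u = x - s u\<close>, the real part in question is \<open>1 - s rho\<close>.\<close>

lemma maximizer_resolvent_bound:
  assumes A: "A \<in> carrier_mat n n" and x: "x \<in> carrier_vec n" "x \<bullet>c x = 1"
    and accr: "\<And>v. v \<in> carrier_vec n \<Longrightarrow> 0 \<le> Re ((A *\<^sub>v v) \<bullet>c v)"
    and eig: "\<And>v. v \<in> carrier_vec n \<Longrightarrow> Re ((A *\<^sub>v x) \<bullet>c v) + Re ((A *\<^sub>v v) \<bullet>c x) = 2 * r * Re (x \<bullet>c v)"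
    and r: "r > 0" and s: "s > 0" and u: "u \<in> carrier_vec n" and eq: "of_real s \<cdot>\<^sub>v u + A *\<^sub>v u = x"
  shows "r / (s + r) \<le> Re ((A *\<^sub>v u) \<bullet>c x)"
proof -
  define \<rho> where "\<rho> = Re (u \<bullet>c x)"
  define U where "U = Re (u \<bullet>c u)"
  have Au: "A *\<^sub>v u \<in> carrier_vec n" "A *\<^sub>v x \<in> carrier_vec n" using A u x by auto
  have Au_x: "Re ((A *\<^sub>v u) \<bullet>c y) = Re (x \<bullet>c y) - s * Re (u \<bullet>c y)" if y: "y \<in> carrier_vec n" for y
  proof -
    have "x \<bullet>c y = of_real s * (u \<bullet>c y) + (A *\<^sub>v u) \<bullet>c y"
      unfolding eq[symmetric] using Au u y
      by (simp add: add_scalar_prod_distrib[of _ n] cscalar_prod_smult[of _ n])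
    then show ?thesis by simp
  qed
  have swap: "Re (x \<bullet>c u) = \<rho>" using cscalar_prod_swap[OF u x(1)] by (simp add: \<rho>_def)
  have rr: "Re ((A *\<^sub>v x) \<bullet>c x) = r" using eig[OF x(1)] x(2) by simp
  have ux: "Re ((A *\<^sub>v u) \<bullet>c x) = 1 - s * \<rho>" using Au_x[OF x(1)] x(2) by (simp add: \<rho>_def)
  have uu: "Re ((A *\<^sub>v u) \<bullet>c u) = \<rho> - s * U" using Au_x[OF u] swap by (simp add: U_def)
  have xu: "Re ((A *\<^sub>v x) \<bullet>c u) = 2 * r * \<rho> - (1 - s * \<rho>)" using eig[OF u] swap ux by simp
  have w: "u + of_real (- \<rho>) \<cdot>\<^sub>v x \<in> carrier_vec n" using u x by simp
  have "0 \<le> Re ((A *\<^sub>v (u + of_real (- \<rho>) \<cdot>\<^sub>v x)) \<bullet>c (u + of_real (- \<rho>) \<cdot>\<^sub>v x))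
      + s * Re ((u + of_real (- \<rho>) \<cdot>\<^sub>v x) \<bullet>c (u + of_real (- \<rho>) \<cdot>\<^sub>v x))"
    using accr[OF w] cscalar_prod_self_Re(3)[OF w] s by simp
  also have "\<dots> = \<rho> - (s + r) * \<rho>\<^sup>2"
  proof -
    \<comment> \<open>The cross terms enter only through the symmetric sum that \<open>eig\<close>
      evaluates, so \<open>A\<close> itself need not be hermitian.\<close>
    have "\<rho> * Re ((A *\<^sub>v u) \<bullet>c x) + \<rho> * Re ((A *\<^sub>v x) \<bullet>c u) = \<rho> * (2 * r * \<rho>)"
      using eig[OF u] swap by (simp add: distrib_left[symmetric] add.commute)
    then show ?thesis
      unfolding quadratic_form_expand[OF A u x(1)] cscalar_prod_expand[OF u x(1)]
      using uu rr x(2) swap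
      by (simp add: U_def[symmetric] \<rho>_def[symmetric] power2_eq_square algebra_simps)
  qed
  finally have "(s + r) * \<rho> * \<rho> \<le> 1 * \<rho>" by (simp add: power2_eq_square)
  moreover have "\<rho> \<ge> 0"
    using accr[OF u] cscalar_prod_self_Re(3)[OF u] s by (simp add: uu U_def)
      (smt (verit) mult_nonneg_nonneg)
  ultimately have "(s + r) * \<rho> \<le> 1"
    by (cases "\<rho> = 0") (auto simp: mult_le_cancel_right)
  then have "s * ((s + r) * \<rho>) \<le> s * 1" using s by (intro mult_left_mono) auto
  then show ?thesis
    using s r by (simp add: ux field_simps)
qed

section \<open>The q-numerical radius\<close>

text \<open>At an eigenvector the quadratic form is the eigenvalue times a positive number. The
  spectrum therefore avoids the branch cut of the power and the poles \<open>-s\<close> of the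
  kernels.\<close>

lemma Pi_s_eigenvalue_pos:
  assumes A: "A \<in> Pi_s n \<alpha>" and e: "poly (char_poly A) e = 0"
  shows "Re e > 0"
proof -
  have carr: "A \<in> carrier_mat n n" using A by (simp add: Pi_s_def)
  obtain v where "eigenvector A v e"
    using e eigenvalue_root_char_poly[OF carr] by (auto simp: eigenvalue_def)
  then have v: "v \<in> carrier_vec n" "v \<noteq> 0\<^sub>v n" "A *\<^sub>v v = e \<cdot>\<^sub>v v"
    using carr by (auto simp: eigenvector_def)
  have "(A *\<^sub>v v) \<bullet>c v = e * of_real (Re (v \<bullet>c v))"
    using v cscalar_prod_smult(1)[OF v(1) v(1), of e] cscalar_prod_self_Re(2)[OF v(1)] by simp
  then have "Re ((A *\<^sub>v v) \<bullet>c v) = Re e * Re (v \<bullet>c v)" by simp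
  then show ?thesis
    using Pi_s_sector(1)[OF A v(1,2)] cscalar_prod_self_pos[OF v(1,2)] by (simp add: zero_less_mult_iff)
qed

lemma smult_one_mult_mat_vec:
  fixes v :: "complex vec"
  assumes v: "v \<in> carrier_vec n"
  shows "(c \<cdot>\<^sub>m 1\<^sub>m n) *\<^sub>v v = c \<cdot>\<^sub>v v"
proof (intro eq_vecI)
  fix i assume "i < dim_vec (c \<cdot>\<^sub>v v)"
  then have i: "i < n" using v by simp
  then have "((c \<cdot>\<^sub>m 1\<^sub>m n) *\<^sub>v v) $ i = (c \<cdot>\<^sub>v unit_vec n i) \<bullet> v" by simp
  also have "\<dots> = c * v $ i" using v i by (simp add: smult_scalar_prod_distrib[of _ n])
  finally show "((c \<cdot>\<^sub>m 1\<^sub>m n) *\<^sub>v v) $ i = (c \<cdot>\<^sub>v v) $ i" using i v by simp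
qed (use v in auto)

lemma mat_poly_eval_eigenvector:
  assumes A: "A \<in> carrier_mat n n" and v: "v \<in> carrier_vec n" "A *\<^sub>v v = k \<cdot>\<^sub>v v"
  shows "mat_poly_eval p A *\<^sub>v v = poly p k \<cdot>\<^sub>v v"
proof (induction p)
  case 0
  show ?case using A v by (intro eq_vecI) (auto simp: mat_poly_eval_0)
next
  case (pCons c p)
  note carr = mat_poly_eval_carrier[OF A]
  have "mat_poly_eval (pCons c p) A *\<^sub>v v = (c \<cdot>\<^sub>m 1\<^sub>m n) *\<^sub>v v + (A * mat_poly_eval p A) *\<^sub>v v"
    unfolding mat_poly_eval_pCons[OF A]
    using A v carr[of p] by (intro add_mult_distrib_mat_vec) auto
  also have "(A * mat_poly_eval p A) *\<^sub>v v = A *\<^sub>v (poly p k \<cdot>\<^sub>v v)"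
    using assoc_mult_mat_vec[OF A carr v(1)] pCons.IH by simp
  also have "\<dots> = poly p k \<cdot>\<^sub>v (k \<cdot>\<^sub>v v)"
    using mult_mat_vec[OF A v(1)] v(2) by simp
  also have "(c \<cdot>\<^sub>m 1\<^sub>m n) *\<^sub>v v = c \<cdot>\<^sub>v v"
    by (rule smult_one_mult_mat_vec[OF v(1)])
  finally show ?case
    using v(1) by (auto intro!: eq_vecI simp: algebra_simps)
qed

text \<open>Coordinates of unit vectors have modulus at most 1, so the sum of the moduli of all
  entries is an upper bound, whatever \<open>q\<close> is. Together with the inserted 0 this makes
  the \<open>Sup\<close> in \<open>q_num_radius\<close> a genuine supremum.\<close>

lemma q_num_radius_bdd:
  assumes M: "M \<in> carrier_mat n n"
  shows "bdd_above (insert 0 {cmod ((M *\<^sub>v x) \<bullet>c y) | x y. x \<in> carrier_vec (dim_col M) \<and>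
    y \<in> carrier_vec (dim_col M) \<and> x \<bullet>c x = 1 \<and> y \<bullet>c y = 1 \<and> x \<bullet>c y = q})"
proof (rule bdd_aboveI)
  fix a assume a: "a \<in> insert 0 {cmod ((M *\<^sub>v x) \<bullet>c y) | x y. x \<in> carrier_vec (dim_col M) \<and>
    y \<in> carrier_vec (dim_col M) \<and> x \<bullet>c x = 1 \<and> y \<bullet>c y = 1 \<and> x \<bullet>c y = q}"
  let ?B = "\<Sum>i<n. \<Sum>j<n. cmod (M $$ (i, j))"
  have unit: "cmod (x $ i) \<le> 1" if x: "x \<in> carrier_vec n" "x \<bullet>c x = 1" and "i < n" for x :: "complex vec" and i
  proof -
    have "(cmod (x $ i))\<^sup>2 \<le> (\<Sum>i<n. (cmod (x $ i))\<^sup>2)"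
      using \<open>i < n\<close> by (intro member_le_sum) auto
    then show ?thesis using cscalar_prod_self_Re(1)[OF x(1)] x(2) by (simp add: abs_square_le_1)
  qed
  have "cmod ((M *\<^sub>v x) \<bullet>c y) \<le> ?B"
    if x: "x \<in> carrier_vec n" "x \<bullet>c x = 1" and y: "y \<in> carrier_vec n" "y \<bullet>c y = 1" for x y
  proof -
    have "cmod ((M *\<^sub>v x) \<bullet>c y) \<le> (\<Sum>i<n. (\<Sum>j<n. cmod (M $$ (i, j)) * 1) * 1)"
      unfolding quadratic_form_sum[OF M x(1) y(1)]
    proof (rule sum_norm_le)
      fix i assume i: "i \<in> {..<n}"
      show "cmod ((\<Sum>j<n. M $$ (i, j) * x $ j) * cnj (y $ i)) \<le> (\<Sum>j<n. cmod (M $$ (i, j)) * 1) * 1"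
        unfolding norm_mult complex_mod_cnj using unit x y i
        by (intro mult_mono sum_norm_le) (auto simp: norm_mult intro!: sum_nonneg mult_left_le)
    qed
    then show ?thesis by simp
  qed
  then show "a \<le> ?B"
    using a M by (auto intro!: sum_nonneg)
qed

lemma q_num_radius_nonneg:
  assumes "M \<in> carrier_mat n n"
  shows "q_num_radius q M \<ge> 0"
  unfolding q_num_radius_def by (rule cSup_upper[OF _ q_num_radius_bdd[OF assms]]) simp

lemma q_num_radius_upper:
  assumes M: "M \<in> carrier_mat n n" and "x \<in> carrier_vec n" "y \<in> carrier_vec n"
    "x \<bullet>c x = 1" "y \<bullet>c y = 1" "x \<bullet>c y = q"
  shows "cmod ((M *\<^sub>v x) \<bullet>c y) \<le> q_num_radius q M"
  unfolding q_num_radius_def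
  by (rule cSup_upper[OF _ q_num_radius_bdd[OF M]]) (use assms in auto)

lemma q_num_radius_least:
  assumes M: "M \<in> carrier_mat n n" and "B \<ge> 0"
    and "\<And>x y. x \<in> carrier_vec n \<Longrightarrow> y \<in> carrier_vec n \<Longrightarrow> x \<bullet>c x = 1 \<Longrightarrow> y \<bullet>c y = 1 \<Longrightarrow> x \<bullet>c y = q
      \<Longrightarrow> cmod ((M *\<^sub>v x) \<bullet>c y) \<le> B"
  shows "q_num_radius q M \<le> B"
  unfolding q_num_radius_def by (rule cSup_least) (use assms in auto)

lemma exists_unit_orthogonal:
  fixes x :: "complex vec"
  assumes n: "n \<ge> 2" and x: "x \<in> carrier_vec n"
  obtains z where "z \<in> carrier_vec n" "z \<bullet>c z = 1" "x \<bullet>c z = 0"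
proof -
  \<comment> \<open>If \<open>x $ 0 = 0\<close>, the first basis vector is orthogonal to
    \<open>x\<close>; otherwise the pair \<open>(- cnj (x $ 1), cnj (x $ 0))\<close> is nonzero and
    orthogonal to the first two coordinates.\<close>
  define z0 where "z0 = (if x $ 0 = 0 then vec n (\<lambda>i. if i = 0 then 1 else 0)
      else vec n (\<lambda>i. if i = 0 then - cnj (x $ 1) else if i = 1 then cnj (x $ 0) else 0))"
  have z0: "z0 \<in> carrier_vec n" by (simp add: z0_def)
  define m where "m = n - 2"
  have m: "n = Suc (Suc m)" using n by (simp add: m_def)
  have "z0 $ 0 \<noteq> 0 \<or> z0 $ 1 \<noteq> 0" using n by (simp add: z0_def)
  moreover have "(0\<^sub>v n :: complex vec) $ 0 = 0" "(0\<^sub>v n :: complex vec) $ 1 = 0"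
    using n by simp_all
  ultimately have nz: "z0 \<noteq> 0\<^sub>v n" by fastforce
  have orth: "x \<bullet>c z0 = 0"
    using cscalar_prod_sum[OF x z0]
    by (auto simp: z0_def m sum.lessThan_Suc_shift simp del: sum.lessThan_Suc)
  obtain u c where u: "u \<in> carrier_vec n" "u \<bullet>c u = 1" and c: "c > 0" "z0 = of_real c \<cdot>\<^sub>v u"
    using normalize_vec[OF z0 nz] by metis
  have "of_real c * (x \<bullet>c u) = 0"
    using orth cscalar_prod_smult(2)[OF x u(1), of "of_real c"] c(2) by simp
  then show ?thesis using that u c by auto
qed

text \<open>Take \<open>y = cnj q x + d z\<close> with \<open>z\<close> a unit vector orthogonal to
  \<open>x\<close> and \<open>d\<close> one of the two square roots of \<open>1 - |q|^2\<close>.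
  Both signs are admissible, and averaging the two values removes the term with
  \<open>z\<close>.\<close>

lemma q_num_radius_ge_numerical_value:
  assumes M: "M \<in> carrier_mat n n" and q: "cmod q \<le> 1" and nq: "n \<ge> 2 \<or> cmod q = 1"
    and x: "x \<in> carrier_vec n" "x \<bullet>c x = 1"
  shows "cmod q * cmod ((M *\<^sub>v x) \<bullet>c x) \<le> q_num_radius q M"
proof -
  define \<delta> where "\<delta> = sqrt (1 - (cmod q)\<^sup>2)"
  have \<delta>: "\<delta>\<^sup>2 = 1 - (cmod q)\<^sup>2" using q by (simp add: \<delta>_def abs_square_le_1)
  \<comment> \<open>When \<open>|q| = 1\<close> the coefficient of \<open>z\<close> is zero and any
    vector serves, which covers dimension one.\<close>
  obtain z where z: "z \<in> carrier_vec n" "\<delta> = 0 \<or> z \<bullet>c z = 1 \<and> x \<bullet>c z = 0"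
  proof (cases "n \<ge> 2")
    case True
    then show ?thesis using exists_unit_orthogonal[OF True x(1)] that by metis
  next
    case False
    then have "\<delta> = 0" using nq by (simp add: \<delta>_def)
    then show ?thesis using that[of x] x by simp
  qed
  have Mx: "M *\<^sub>v x \<in> carrier_vec n" using M x by auto
  have bound: "cmod (q * ((M *\<^sub>v x) \<bullet>c x) + of_real d * ((M *\<^sub>v x) \<bullet>c z)) \<le> q_num_radius q M"
    if d: "d\<^sup>2 = \<delta>\<^sup>2" for d :: real
  proof -
    define y where "y = cnj q \<cdot>\<^sub>v x + of_real d \<cdot>\<^sub>v z"
    have d0: "d = 0 \<or> z \<bullet>c z = 1 \<and> x \<bullet>c z = 0" using z(2) d by auto
    have zx: "d = 0 \<or> z \<bullet>c x = 0" using d0 cscalar_prod_swap[OF x(1) z(1)] by auto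
    have y: "y \<in> carrier_vec n" using x z by (simp add: y_def)
    have cx: "cnj q \<cdot>\<^sub>v x \<in> carrier_vec n" using x by simp
    have right: "w \<bullet>c y = q * (w \<bullet>c x) + of_real d * (w \<bullet>c z)" if w: "w \<in> carrier_vec n" for w
    proof -
      have "w \<bullet>c y = cnj (y \<bullet>c w)" using cscalar_prod_swap[OF y w] .
      also have "y \<bullet>c w = cnj q * (x \<bullet>c w) + of_real d * (z \<bullet>c w)"
        unfolding y_def using x z w
        by (simp add: add_scalar_prod_distrib[of _ n] cscalar_prod_smult[of _ n])
      finally show ?thesis
        using cscalar_prod_swap[OF w x(1)] cscalar_prod_swap[OF w z(1)] by simp
    qed
    have xy: "x \<bullet>c y = q" using right[OF x(1)] x d0 by auto
    have zy: "of_real d * (z \<bullet>c y) = of_real (d\<^sup>2)"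
      using right[OF z(1)] zx d0 by (auto simp: power2_eq_square)
    have "y \<bullet>c y = cnj q * (x \<bullet>c y) + of_real d * (z \<bullet>c y)"
      using x z y by (subst (1) y_def) (simp add: add_scalar_prod_distrib[of _ n] cscalar_prod_smult[of _ n])
    also have "\<dots> = of_real ((cmod q)\<^sup>2 + d\<^sup>2)"
      unfolding xy zy of_real_add complex_norm_square by (simp add: mult.commute)
    also have "\<dots> = 1" by (simp add: d \<delta>)
    finally have "y \<bullet>c y = 1" .
    from q_num_radius_upper[OF M x(1) y x(2) this xy] show ?thesis
      unfolding right[OF Mx] .
  qed
  let ?a = "q * ((M *\<^sub>v x) \<bullet>c x)" and ?b = "of_real \<delta> * ((M *\<^sub>v x) \<bullet>c z)"
  have "2 * cmod ?a = cmod ((?a + ?b) + (?a - ?b))"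
    by (simp add: norm_mult flip: mult_2)
  also have "\<dots> \<le> cmod (?a + ?b) + cmod (?a - ?b)" by (rule norm_triangle_ineq)
  also have "\<dots> \<le> 2 * q_num_radius q M"
    using bound[of \<delta>] bound[of "- \<delta>"] by simp
  finally show ?thesis by (simp add: norm_mult)
qed

text \<open>No unit vectors exist in dimension zero, and in dimension one two unit vectors have an
  inner product of modulus 1. Only the inserted 0 remains under the supremum.\<close>

lemma q_num_radius_eq_0:
  assumes M: "M \<in> carrier_mat n n" and n: "n = 0 \<or> n = 1 \<and> cmod q \<noteq> 1"
  shows "q_num_radius q M = 0"
proof (rule antisym[OF q_num_radius_least[OF M] q_num_radius_nonneg[OF M]])
  fix x y :: "complex vec"
  assume xy: "x \<in> carrier_vec n" "y \<in> carrier_vec n" "x \<bullet>c x = 1" "y \<bullet>c y = 1" "x \<bullet>c y = q"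
  have False
  proof (cases "n = 0")
    case True
    then show ?thesis using cscalar_prod_sum[OF xy(1,1)] xy(3) by simp
  next
    case False
    then have n1: "n = 1" "cmod q \<noteq> 1" using n by auto
    have "cmod (x $ 0) = 1" "cmod (y $ 0) = 1"
      using cscalar_prod_self_Re(1)[OF xy(1)] cscalar_prod_self_Re(1)[OF xy(2)] xy(3,4) n1
      by (auto simp: power2_eq_1_iff intro: norm_ge_zero)
        (smt (verit) norm_ge_zero)+
    then show ?thesis using cscalar_prod_sum[OF xy(1,2)] xy(5) n1 by (auto simp: norm_mult)
  qed
  then show "cmod ((M *\<^sub>v x) \<bullet>c y) \<le> 0" ..
qed simp

section \<open>Powers of sectorial matrices\<close>

lemma principal_pow_0:
  assumes A: "A \<in> Pi_s n \<alpha>"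
  shows "principal_pow 0 A = 1\<^sub>m n"
proof -
  have carr: "A \<in> carrier_mat n n" using A by (simp add: Pi_s_def)
  have "interpolates A (\<lambda>z. z powr of_real 0) [:1:]"
    unfolding interpolates_def
  proof (intro allI impI)
    fix e j assume "poly (char_poly A) e = 0"
    then have "e \<in> {z. Re z > 0}" using Pi_s_eigenvalue_pos[OF A] by simp
    \<comment> \<open>\<open>z powr 0\<close> is 1 away from the origin but 0 at the origin, so it
      is compared with the constant on the half-plane only.\<close>
    moreover have "(\<lambda>z. z powr of_real 0) holomorphic_on {z. Re z > 0}"
      by (rule holomorphic_transform[of "\<lambda>_. 1"]) auto
    ultimately show "(deriv ^^ j) (poly [:1:]) e = (deriv ^^ j) (\<lambda>z. z powr of_real 0) e"
      by (intro higher_deriv_transform_within_open[OF _ _ open_halfspace_Re_gt[of 0]])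
         (auto intro!: holomorphic_intros)
  qed
  then show ?thesis
    using principal_pow_eq[OF carr, of 0] mat_poly_eval_const[OF carr, of 1]
    by (auto intro!: eq_matI)
qed

lemma principal_pow_1:
  assumes "A \<in> carrier_mat n n"
  shows "principal_pow 1 A = A"
proof -
  \<comment> \<open>This equality of functions includes the origin, because
    \<open>0 powr 1 = 0\<close>, so the derivatives agree everywhere.\<close>
  have "poly [:0, 1:] = (\<lambda>z::complex. z powr of_real 1)"
    by (rule ext) (auto simp: powr_def)
  then have "interpolates A (\<lambda>z. z powr of_real 1) [:0, 1:]"
    unfolding interpolates_def by (simp only:) simp
  then show ?thesis
    using principal_pow_eq[OF assms, of 1] mat_poly_eval_X[OF assms] by simp
qed

text \<open>The eigenvalue \<open>k\<close> is a root of the characteristic polynomial, so the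
  interpolation condition of order zero gives \<open>p(k) = k powr t\<close>. The exponent may be
  negative, as it is for the inverse powers.\<close>

lemma principal_pow_eigenvector:
  assumes A: "A \<in> carrier_mat n n" and v: "v \<in> carrier_vec n" "v \<noteq> 0\<^sub>v n" "A *\<^sub>v v = k \<cdot>\<^sub>v v"
  shows "principal_pow t A *\<^sub>v v = (k powr of_real t) \<cdot>\<^sub>v v"
proof -
  obtain p where p: "interpolates A (\<lambda>z. z powr of_real t) p" by (rule interpolates_exists[OF A])
  have "eigenvector A v k" using A v by (auto simp: eigenvector_def)
  then have root: "poly (char_poly A) k = 0"
    using eigenvalue_root_char_poly[OF A] by (auto simp: eigenvalue_def)
  then have "order k (char_poly A) > 0"
    using char_poly_nonzero[OF A] order_root by blast
  with p root have "(deriv ^^ 0) (poly p) k = (deriv ^^ 0) (\<lambda>z. z powr of_real t) k"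
    unfolding interpolates_def by blast
  then show ?thesis
    using mat_poly_eval_eigenvector[OF A v(1,3)] by (simp add: principal_pow_eq[OF A p])
qed

text \<open>One triple \<open>E\<close>, \<open>m\<close>, \<open>c\<close> represents all powers
  and, for every \<open>s\<close>, the vector \<open>A (s + A)^(-1) x\<close> tested against
  \<open>y\<close>. Bounds on the latter thus transfer to the powers.\<close>

lemma principal_pow_as_hermite_functional:
  assumes A: "A \<in> Pi_s n \<alpha>" and x: "x \<in> carrier_vec n" and y: "y \<in> carrier_vec n"
  obtains E m c where "finite E" "E \<subseteq> {z. Re z > 0}"
    "\<And>t. (principal_pow t A *\<^sub>v x) \<bullet>c y = hermite_functional E m c (\<lambda>z. z powr of_real t)"
    "\<And>s. s > 0 \<Longrightarrow> \<exists>u\<in>carrier_vec n. of_real s \<cdot>\<^sub>v u + A *\<^sub>v u = x \<and>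
      hermite_functional E m c (\<lambda>z. z / (of_real s + z)) = (A *\<^sub>v u) \<bullet>c y"
proof -
  have carr: "A \<in> carrier_mat n n" using A by (simp add: Pi_s_def)
  let ?E = "{e. poly (char_poly A) e = 0}" and ?m = "\<lambda>e. order e (char_poly A)"
  obtain c where c: "\<And>f p. interpolates A f p \<Longrightarrow>
      (mat_poly_eval p A *\<^sub>v x) \<bullet>c y = hermite_functional ?E ?m c f"
    using hermite_functional_exists[OF carr x y] by blast
  show ?thesis
  proof
    show "finite ?E" using char_poly_nonzero[OF carr] by (rule poly_roots_finite)
    show "?E \<subseteq> {z. Re z > 0}" using Pi_s_eigenvalue_pos[OF A] by auto
    show "(principal_pow t A *\<^sub>v x) \<bullet>c y = hermite_functional ?E ?m c (\<lambda>z. z powr of_real t)" for t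
    proof -
      obtain p where p: "interpolates A (\<lambda>z. z powr of_real t) p" by (rule interpolates_exists[OF carr])
      show ?thesis using c[OF p] by (simp add: principal_pow_eq[OF carr p])
    qed
    show "\<exists>u\<in>carrier_vec n. of_real s \<cdot>\<^sub>v u + A *\<^sub>v u = x \<and>
        hermite_functional ?E ?m c (\<lambda>z. z / (of_real s + z)) = (A *\<^sub>v u) \<bullet>c y" if s: "s > 0" for s
    proof -
      obtain Q where Q: "Q \<in> carrier_mat n n" "(of_real s \<cdot>\<^sub>m 1\<^sub>m n + A) * Q = 1\<^sub>m n"
        "\<exists>p. interpolates A (\<lambda>z. z / (of_real s + z)) p \<and> mat_poly_eval p A = A * Q"
        using resolvent_eval[OF carr Pi_s_eigenvalue_pos[OF A] s] by metis
      then obtain p where p: "interpolates A (\<lambda>z. z / (of_real s + z)) p" "mat_poly_eval p A = A * Q"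
        by blast
      let ?u = "Q *\<^sub>v x"
      have u: "?u \<in> carrier_vec n" using Q(1) x by simp
      have "x = ((of_real s \<cdot>\<^sub>m 1\<^sub>m n + A) * Q) *\<^sub>v x" unfolding Q(2) using x by simp
      also have "\<dots> = (of_real s \<cdot>\<^sub>m 1\<^sub>m n + A) *\<^sub>v ?u"
        using carr Q(1) x by (intro assoc_mult_mat_vec) auto
      also have "\<dots> = (of_real s \<cdot>\<^sub>m 1\<^sub>m n) *\<^sub>v ?u + A *\<^sub>v ?u"
        using carr u by (intro add_mult_distrib_mat_vec) auto
      also have "(of_real s \<cdot>\<^sub>m 1\<^sub>m n) *\<^sub>v ?u = of_real s \<cdot>\<^sub>v ?u"
        by (rule smult_one_mult_mat_vec[OF u])
      finally have "of_real s \<cdot>\<^sub>v ?u + A *\<^sub>v ?u = x" ..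
      moreover have "hermite_functional ?E ?m c (\<lambda>z. z / (of_real s + z)) = (A *\<^sub>v ?u) \<bullet>c y"
        using c[OF p(1)] p(2) assoc_mult_mat_vec[OF carr Q(1) x] by simp
      ultimately show ?thesis using u by blast
    qed
  qed
qed

text \<open>All estimates are expressed through the single number \<open>r\<close>, the maximum of
  the real part of the form, so that bounds for \<open>A\<close> and for its power can be traded
  against each other.\<close>

lemma Pi_s_power_bounds:
  assumes \<alpha>: "0 \<le> \<alpha>" "\<alpha> < pi / 2" and A: "A \<in> Pi_s n \<alpha>" and n: "n > 0" and t: "0 \<le> t" "t \<le> 1"
  obtains r x where "r > 0" "x \<in> carrier_vec n" "x \<bullet>c x = 1" "Re ((A *\<^sub>v x) \<bullet>c x) = r"
    "r powr t \<le> Re ((principal_pow t A *\<^sub>v x) \<bullet>c x)"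
    "\<And>u v. u \<in> carrier_vec n \<Longrightarrow> v \<in> carrier_vec n \<Longrightarrow> u \<bullet>c u = 1 \<Longrightarrow> v \<bullet>c v = 1 \<Longrightarrow>
      cmod ((A *\<^sub>v u) \<bullet>c v) \<le> r / cos \<alpha>"
    "\<And>u v. u \<in> carrier_vec n \<Longrightarrow> v \<in> carrier_vec n \<Longrightarrow> u \<bullet>c u = 1 \<Longrightarrow> v \<bullet>c v = 1 \<Longrightarrow>
      cmod ((principal_pow t A *\<^sub>v u) \<bullet>c v) \<le> (r / (cos \<alpha>)\<^sup>2) powr t"
proof -
  have carr: "A \<in> carrier_mat n n" using A by (simp add: Pi_s_def)
  have cos: "0 < cos \<alpha>" "cos \<alpha> \<le> 1" using \<alpha> by (auto intro!: cos_gt_zero_pi)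
  obtain x where x: "x \<in> carrier_vec n" "x \<bullet>c x = 1"
    and xmax: "\<And>y. y \<in> carrier_vec n \<Longrightarrow> y \<bullet>c y = 1 \<Longrightarrow> Re ((A *\<^sub>v y) \<bullet>c y) \<le> Re ((A *\<^sub>v x) \<bullet>c x)"
    using quadratic_form_maximizer[OF carr n] by blast
  define r where "r = Re ((A *\<^sub>v x) \<bullet>c x)"
  define m where "m = r / (cos \<alpha>)\<^sup>2"
  have "x \<noteq> 0\<^sub>v n" using x cscalar_prod_sum[OF x(1,1)] by auto
  then have r: "r > 0" unfolding r_def by (rule Pi_s_sector(1)[OF A x(1)])
  have m: "m > 0" using r cos by (simp add: m_def)
  have max: "Re ((A *\<^sub>v v) \<bullet>c v) \<le> r * Re (v \<bullet>c v)" if "v \<in> carrier_vec n" for v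
    using quadratic_form_le_max[OF carr _ that] xmax by (simp add: r_def)
  have accr: "0 \<le> Re ((A *\<^sub>v v) \<bullet>c v)" if v: "v \<in> carrier_vec n" for v
  proof (cases "v = 0\<^sub>v n")
    case True
    have "A *\<^sub>v 0\<^sub>v n \<in> carrier_vec n" using carr by auto
    then show ?thesis unfolding True by (simp add: cscalar_prod_sum[of _ n])
  next
    case False
    then show ?thesis using Pi_s_sector(1)[OF A v] by simp
  qed
  have bound: "cmod ((A *\<^sub>v u) \<bullet>c v) \<le> r / cos \<alpha>"
    if "u \<in> carrier_vec n" "v \<in> carrier_vec n" "u \<bullet>c u = 1" "v \<bullet>c v = 1" for u v
  proof -
    have "cmod ((A *\<^sub>v u) \<bullet>c v) \<le> (Re ((A *\<^sub>v u) \<bullet>c u) + Re ((A *\<^sub>v v) \<bullet>c v)) / (2 * cos \<alpha>)"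
      by (rule Pi_s_form_bound[OF \<alpha> A that(1,2)])
    also have "\<dots> \<le> (r + r) / (2 * cos \<alpha>)"
      using max[OF that(1)] max[OF that(2)] that(3,4) cos by (intro divide_right_mono) auto
    finally show ?thesis by simp
  qed
  have coco: "Re ((A *\<^sub>v u) \<bullet>c (A *\<^sub>v u)) \<le> m * Re ((A *\<^sub>v u) \<bullet>c u)" if u: "u \<in> carrier_vec n" for u
  proof -
    define w where "w = A *\<^sub>v u"
    define W where "W = Re (w \<bullet>c w)"
    \<comment> \<open>\<open>Pi_s_form_bound\<close> at \<open>u\<close> and \<open>mu w\<close>
      gives \<open>W (2 mu cos \<alpha> - r mu^2) <= Re <w, u>\<close>. This \<open>mu\<close>
      maximises the factor of \<open>W\<close>, whose value is then
      \<open>(cos \<alpha>)^2 / r = 1 / m\<close>.\<close>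
    define \<mu> where "\<mu> = cos \<alpha> / r"
    have w: "w \<in> carrier_vec n" using carr u by (simp add: w_def)
    have W: "w \<bullet>c w = of_real W" "W \<ge> 0" using cscalar_prod_self_Re[OF w] by (auto simp: W_def)
    have \<mu>: "\<mu> > 0" using cos r by (simp add: \<mu>_def)
    have \<mu>w: "of_real \<mu> \<cdot>\<^sub>v w \<in> carrier_vec n" using w by simp
    have "w \<bullet>c (of_real \<mu> \<cdot>\<^sub>v w) = of_real (\<mu> * W)"
      using cscalar_prod_smult(2)[OF w w, of "of_real \<mu>"] W(1) by simp
    then have "\<mu> * W = cmod ((A *\<^sub>v u) \<bullet>c (of_real \<mu> \<cdot>\<^sub>v w))"
      using \<mu> W(2) by (simp add: w_def[symmetric] abs_mult norm_mult)
    also have "\<dots> \<le> (Re (w \<bullet>c u) + Re ((A *\<^sub>v (of_real \<mu> \<cdot>\<^sub>v w)) \<bullet>c (of_real \<mu> \<cdot>\<^sub>v w))) / (2 * cos \<alpha>)"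
      using Pi_s_form_bound[OF \<alpha> A u \<mu>w] by (simp add: w_def)
    also have "\<dots> \<le> (Re (w \<bullet>c u) + r * (\<mu>\<^sup>2 * W)) / (2 * cos \<alpha>)"
    proof -
      have "(of_real \<mu> \<cdot>\<^sub>v w) \<bullet>c (of_real \<mu> \<cdot>\<^sub>v w) = of_real (\<mu>\<^sup>2 * W)"
        using cscalar_prod_smult_self[OF w, of "of_real \<mu>"] W(1) by simp
      then show ?thesis
        using max[OF \<mu>w] cos by (intro divide_right_mono) auto
    qed
    also have "r * (\<mu>\<^sup>2 * W) = \<mu> * cos \<alpha> * W"
      using r by (simp add: \<mu>_def power2_eq_square)
    finally have "\<mu> * W * (2 * cos \<alpha>) \<le> Re (w \<bullet>c u) + \<mu> * cos \<alpha> * W"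
      using cos by (simp add: pos_le_divide_eq)
    then have "W * (cos \<alpha> * \<mu>) \<le> Re (w \<bullet>c u)" by (simp add: algebra_simps)
    then have "W * (cos \<alpha> * \<mu>) * m \<le> Re (w \<bullet>c u) * m" using m by (intro mult_right_mono) auto
    moreover have "cos \<alpha> * \<mu> * m = 1" using cos r by (simp add: \<mu>_def m_def power2_eq_square)
    moreover have "W * (cos \<alpha> * \<mu>) * m = W * (cos \<alpha> * \<mu> * m)" by simp
    ultimately have "W \<le> Re (w \<bullet>c u) * m" by (metis mult.right_neutral)
    then show ?thesis by (simp add: W_def w_def mult.commute)
  qed
  have eig: "Re ((A *\<^sub>v x) \<bullet>c v) + Re ((A *\<^sub>v v) \<bullet>c x) = 2 * r * Re (x \<bullet>c v)" if "v \<in> carrier_vec n" for v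
    using quadratic_form_maximizer_eigen[OF carr x max _ that] by (simp add: r_def)
  have lower: "r powr t \<le> Re ((principal_pow t A *\<^sub>v x) \<bullet>c x)"
  proof -
    \<comment> \<open>The endpoints are handled directly, since the integral representation is
      restricted to exponents strictly between 0 and 1.\<close>
    consider "t = 0" | "t = 1" | "0 < t" "t < 1" using t by linarith
    then show ?thesis
    proof cases
      case 1
      then show ?thesis using x r by (simp add: principal_pow_0[OF A])
    next
      case 2
      then show ?thesis using r by (simp add: principal_pow_1[OF carr] r_def)
    next
      case 3
      show ?thesis
      proof (rule principal_pow_as_hermite_functional[OF A x(1) x(1)])
        fix E k c
        assume E: "finite E" "E \<subseteq> {z. Re z > 0}"
          and pow: "\<And>t. (principal_pow t A *\<^sub>v x) \<bullet>c x = hermite_functional E k c (\<lambda>z. z powr of_real t)"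
          and res: "\<And>s. s > 0 \<Longrightarrow> \<exists>u\<in>carrier_vec n. of_real s \<cdot>\<^sub>v u + A *\<^sub>v u = x \<and>
            hermite_functional E k c (\<lambda>z. z / (of_real s + z)) = (A *\<^sub>v u) \<bullet>c x"
        show ?thesis
          unfolding pow
        proof (rule hermite_functional_powr_lower[OF E 3 r])
          fix s :: real assume s: "s > 0"
          then obtain u where "u \<in> carrier_vec n" "of_real s \<cdot>\<^sub>v u + A *\<^sub>v u = x"
            "hermite_functional E k c (\<lambda>z. z / (of_real s + z)) = (A *\<^sub>v u) \<bullet>c x" using res by blast
          then show "r / (s + r) \<le> Re (hermite_functional E k c (\<lambda>z. z / (of_real s + z)))"
            using maximizer_resolvent_bound[OF carr x accr eig r s] by simp
        qed
      qed
    qed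
  qed
  have upper: "cmod ((principal_pow t A *\<^sub>v u) \<bullet>c v) \<le> m powr t"
    if uv: "u \<in> carrier_vec n" "v \<in> carrier_vec n" "u \<bullet>c u = 1" "v \<bullet>c v = 1" for u v
  proof -
    consider "t = 0" | "t = 1" | "0 < t" "t < 1" using t by linarith
    then show ?thesis
    proof cases
      case 1
      then show ?thesis using uv m cscalar_prod_cauchy_schwarz[OF uv(1,2)] by (simp add: principal_pow_0[OF A])
    next
      case 2
      have "r / cos \<alpha> \<le> m" unfolding m_def
        using cos r by (intro divide_left_mono) (auto simp: power2_eq_square)
      then show ?thesis using 2 m bound[OF uv] by (simp add: principal_pow_1[OF carr])
    next
      case 3
      show ?thesis
      proof (rule principal_pow_as_hermite_functional[OF A uv(1,2)])
        fix E k c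
        assume E: "finite E" "E \<subseteq> {z. Re z > 0}"
          and pow: "\<And>t. (principal_pow t A *\<^sub>v u) \<bullet>c v = hermite_functional E k c (\<lambda>z. z powr of_real t)"
          and res: "\<And>s. s > 0 \<Longrightarrow> \<exists>w\<in>carrier_vec n. of_real s \<cdot>\<^sub>v w + A *\<^sub>v w = u \<and>
            hermite_functional E k c (\<lambda>z. z / (of_real s + z)) = (A *\<^sub>v w) \<bullet>c v"
        show ?thesis
          unfolding pow
        proof (rule hermite_functional_powr_upper[OF E 3 m])
          fix s :: real assume s: "s > 0"
          then obtain w where w: "w \<in> carrier_vec n" "of_real s \<cdot>\<^sub>v w + A *\<^sub>v w = u"
            "hermite_functional E k c (\<lambda>z. z / (of_real s + z)) = (A *\<^sub>v w) \<bullet>c v" using res by blast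
          have Aw: "A *\<^sub>v w \<in> carrier_vec n" using carr w by simp
          have "Re ((A *\<^sub>v w) \<bullet>c (A *\<^sub>v w)) \<le> (m / (s + m))\<^sup>2"
            using cocoercive_resolvent_bound[OF Aw w(1) m s coco[OF w(1)] w(2)] uv(3) by simp
          then have "sqrt (Re ((A *\<^sub>v w) \<bullet>c (A *\<^sub>v w))) \<le> m / (s + m)"
            using m s by (intro real_le_lsqrt) auto
          then show "cmod (hermite_functional E k c (\<lambda>z. z / (of_real s + z))) \<le> m / (s + m)"
            using cscalar_prod_cauchy_schwarz[OF Aw uv(2)] uv(4) w(3) by simp
        qed
      qed
    qed
  qed
  show ?thesis
    by (rule that[OF r x r_def[symmetric] lower bound upper[unfolded m_def]])
qed

theorem theorem2p21:
  fixes n :: nat and A :: "complex mat" and \<alpha> t :: real and q :: complex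
  assumes "0 \<le> \<alpha>" and "\<alpha> < pi / 2"
    and "A \<in> Pi_s n \<alpha>"
    and "0 < cmod q" and "cmod q \<le> 1"
    and "0 \<le> t" and "t \<le> 1"
  shows "cmod q powr (t + 1) * cos \<alpha> powr t * q_num_radius q A powr t
           \<le> cmod q powr t * q_num_radius q (principal_pow t A)
       \<and> cmod q powr t * q_num_radius q (principal_pow t A)
           \<le> (1 / cos \<alpha>) powr (2 * t) * (1 / cos (t * \<alpha>)) * q_num_radius q A powr t
       \<and> cmod q powr (t + 1) * cos (t * \<alpha>) * cos \<alpha> powr (2 * t) * q_num_radius q A powr (- t)
           \<le> q_num_radius q (principal_pow (- t) A)"
proof -
  note \<alpha> = assms(1,2) and A = assms(3) and q = assms(4,5) and t = assms(6,7)
  have carr: "A \<in> carrier_mat n n" using A by (simp add: Pi_s_def)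
  note pcarr = principal_pow_carrier[OF carr]
  have cos: "0 < cos \<alpha>" "cos \<alpha> \<le> 1" using \<alpha> by (auto intro!: cos_gt_zero_pi)
  have "t * \<alpha> \<le> 1 * \<alpha>" using t \<alpha> by (intro mult_right_mono) auto
  moreover have "0 \<le> t * \<alpha>" using t \<alpha> by simp
  ultimately have "- (pi / 2) < t * \<alpha>" "t * \<alpha> < pi / 2" using \<alpha>(2) pi_gt_zero by linarith+
  then have cost: "0 < cos (t * \<alpha>)" "cos (t * \<alpha>) \<le> 1"
    by (auto intro!: cos_gt_zero_pi)
  show ?thesis
  proof (cases "n = 0 \<or> n = 1 \<and> cmod q \<noteq> 1")
    \<comment> \<open>All radii vanish, and \<open>0 powr y = 0\<close> for every \<open>y\<close>
      including 0, so each inequality reads \<open>0 <= 0\<close>.\<close>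
    case True
    then show ?thesis
      using q_num_radius_eq_0[OF carr] q_num_radius_eq_0[OF pcarr] by simp
  next
    case False
    then have n: "n > 0" and nq: "n \<ge> 2 \<or> cmod q = 1" by linarith+
    note ge = q_num_radius_ge_numerical_value[OF _ q(2) nq]
    define w where "w = q_num_radius q A"
    show ?thesis
    proof (rule Pi_s_power_bounds[OF \<alpha> A n t])
      fix r x
      assume r: "r > 0" and x: "x \<in> carrier_vec n" "x \<bullet>c x = 1" and rx: "Re ((A *\<^sub>v x) \<bullet>c x) = r"
        and lower: "r powr t \<le> Re ((principal_pow t A *\<^sub>v x) \<bullet>c x)"
        and bound: "\<And>u v. u \<in> carrier_vec n \<Longrightarrow> v \<in> carrier_vec n \<Longrightarrow> u \<bullet>c u = 1 \<Longrightarrow> v \<bullet>c v = 1 \<Longrightarrow>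
          cmod ((A *\<^sub>v u) \<bullet>c v) \<le> r / cos \<alpha>"
        and upper: "\<And>u v. u \<in> carrier_vec n \<Longrightarrow> v \<in> carrier_vec n \<Longrightarrow> u \<bullet>c u = 1 \<Longrightarrow> v \<bullet>c v = 1 \<Longrightarrow>
          cmod ((principal_pow t A *\<^sub>v u) \<bullet>c v) \<le> (r / (cos \<alpha>)\<^sup>2) powr t"
      have "cmod q * r \<le> cmod q * cmod ((A *\<^sub>v x) \<bullet>c x)"
        using rx complex_Re_le_cmod by (intro mult_left_mono) auto
      also have "\<dots> \<le> w" unfolding w_def by (rule ge[OF carr x])
      finally have w_ge: "cmod q * r \<le> w" .
      then have w: "w > 0" using q r by (smt (verit) mult_pos_pos)
      have w_le: "w \<le> r / cos \<alpha>"
        unfolding w_def using bound r cos by (intro q_num_radius_least[OF carr]) auto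
      have "cmod q * r powr t \<le> cmod q * cmod ((principal_pow t A *\<^sub>v x) \<bullet>c x)"
        using lower complex_Re_le_cmod[of "(principal_pow t A *\<^sub>v x) \<bullet>c x"]
        by (intro mult_left_mono) auto
      also have "\<dots> \<le> q_num_radius q (principal_pow t A)" by (rule ge[OF pcarr x])
      finally have wt_ge: "cmod q * r powr t \<le> q_num_radius q (principal_pow t A)" .
      have wt_le: "q_num_radius q (principal_pow t A) \<le> (r / (cos \<alpha>)\<^sup>2) powr t"
        using upper by (intro q_num_radius_least[OF pcarr]) auto
      have "cmod q powr (t + 1) * cos \<alpha> powr t * w powr t
          \<le> cmod q powr t * q_num_radius q (principal_pow t A)"
      proof -
        have "cos \<alpha> powr t * w powr t = (cos \<alpha> * w) powr t" using cos w by (simp add: powr_mult)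
        also have "\<dots> \<le> r powr t"
          using w_le cos w t by (intro powr_mono2) (auto simp: field_simps)
        finally have "cmod q powr t * (cmod q * (cos \<alpha> powr t * w powr t)) \<le> cmod q powr t * (cmod q * r powr t)"
          by (intro mult_left_mono) auto
        also have "\<dots> \<le> cmod q powr t * q_num_radius q (principal_pow t A)"
          using wt_ge by (intro mult_left_mono) auto
        finally show ?thesis using q by (simp add: powr_add algebra_simps)
      qed
      moreover have "cmod q powr t * q_num_radius q (principal_pow t A)
          \<le> (1 / cos \<alpha>) powr (2 * t) * (1 / cos (t * \<alpha>)) * w powr t"
      proof -
        \<comment> \<open>The factor \<open>cmod q powr t\<close> is absorbed into the base of the
          power, where \<open>cmod q * r\<close> is at most \<open>w\<close>.\<close>
        have "cmod q powr t * q_num_radius q (principal_pow t A) \<le> cmod q powr t * (r / (cos \<alpha>)\<^sup>2) powr t"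
          using wt_le by (intro mult_left_mono) auto
        also have "\<dots> = (cmod q * r * (1 / cos \<alpha>)\<^sup>2) powr t"
          using q r cos by (simp add: powr_mult[symmetric] power_divide)
        also have "\<dots> = (cmod q * r) powr t * (1 / cos \<alpha>) powr (2 * t)"
          using q r cos by (simp add: powr_mult powr_powr[symmetric] powr_numeral)
        also have "\<dots> \<le> w powr t * (1 / cos \<alpha>) powr (2 * t)"
          using w_ge q r t by (intro mult_right_mono powr_mono2) auto
        also have "\<dots> = w powr t * (1 / cos \<alpha>) powr (2 * t) * 1" by simp
        \<comment> \<open>The factor \<open>1 / cos (t * \<alpha>)\<close> is at least 1.\<close>
        also have "\<dots> \<le> w powr t * (1 / cos \<alpha>) powr (2 * t) * (1 / cos (t * \<alpha>))"
          using cost by (intro mult_left_mono) auto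
        finally show ?thesis by (simp only: mult_ac)
      qed
      moreover have "cmod q powr (t + 1) * cos (t * \<alpha>) * cos \<alpha> powr (2 * t) * w powr (- t)
          \<le> q_num_radius q (principal_pow (- t) A)"
      proof -
        \<comment> \<open>Positive dimension makes the characteristic polynomial nonconstant, which
          yields an eigenvalue.\<close>
        have "\<not> constant (poly (char_poly A))"
          using degree_monic_char_poly[OF carr] n by (simp add: constant_degree)
        from Fundamental_Theorem_Algebra.fundamental_theorem_of_algebra[OF this]
        obtain k where k: "poly (char_poly A) k = 0" by (rule exE)
        then obtain v0 where "eigenvector A v0 k"
          using eigenvalue_root_char_poly[OF carr] by (auto simp: eigenvalue_def)
        then have v0: "v0 \<in> carrier_vec n" "v0 \<noteq> 0\<^sub>v n" "A *\<^sub>v v0 = k \<cdot>\<^sub>v v0"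
          using carr by (auto simp: eigenvector_def)
        obtain v c where v: "v \<in> carrier_vec n" "v \<bullet>c v = 1" and c: "c > 0" "v0 = of_real c \<cdot>\<^sub>v v"
          using normalize_vec[OF v0(1,2)] by metis
        have vnz: "v \<noteq> 0\<^sub>v n" using v cscalar_prod_sum[OF v(1,1)] by auto
        have eig: "A *\<^sub>v v = k \<cdot>\<^sub>v v"
        proof -
          have v_eq: "v = of_real (1 / c) \<cdot>\<^sub>v v0"
            using c v by (simp add: smult_smult_assoc flip: of_real_mult)
          show ?thesis
            unfolding v_eq mult_mat_vec[OF carr v0(1)] v0(3) by (simp add: smult_smult_assoc mult.commute)
        qed
        have knz: "k \<noteq> 0" using Pi_s_eigenvalue_pos[OF A k] by auto
        \<comment> \<open>At the unit eigenvector the form equals \<open>k\<close>. The resulting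
          lower bound for \<open>w\<close> becomes an upper bound under the nonpositive exponent
          \<open>- t\<close>.\<close>
        have "cmod q * cmod k \<le> w"
          using ge[OF carr v] v cscalar_prod_smult(1)[OF v(1,1), of k] by (simp add: eig w_def)
        then have "w powr (- t) \<le> (cmod q * cmod k) powr (- t)"
          using q knz t by (intro powr_mono2') auto
        also have "\<dots> = cmod q powr (- t) * cmod k powr (- t)" by (simp add: powr_mult)
        finally have "cmod q powr (t + 1) * w powr (- t)
            \<le> cmod q powr (t + 1) * (cmod q powr (- t) * cmod k powr (- t))"
          by (intro mult_left_mono) auto
        \<comment> \<open>The exponents \<open>t + 1\<close> and \<open>- t\<close> leave a single
          factor \<open>cmod q\<close>, which is what \<open>ge\<close> needs for the inverse power
          at the same eigenvector.\<close>
        also have "\<dots> = cmod q * cmod k powr (- t)"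
          using q by (simp add: powr_add[symmetric] mult.assoc[symmetric])
        also have "\<dots> \<le> q_num_radius q (principal_pow (- t) A)"
        proof -
          have "cmod ((principal_pow (- t) A *\<^sub>v v) \<bullet>c v) = cmod k powr (- t)"
            unfolding principal_pow_eigenvector[OF carr v(1) vnz eig]
            using norm_powr_real_powr'[of "of_real (- t)" k] v
            by (simp add: cscalar_prod_smult[OF v(1,1)])
          then show ?thesis using ge[OF pcarr v] by metis
        qed
        finally have main: "cmod q powr (t + 1) * w powr (- t) \<le> q_num_radius q (principal_pow (- t) A)" .
        \<comment> \<open>Both cosine factors lie between 0 and 1, so inserting them only lowers the
          left side of \<open>main\<close>.\<close>
        have "cos (t * \<alpha>) * cos \<alpha> powr (2 * t) \<le> 1 * 1"
          using cost cos t by (intro mult_mono powr_le1) auto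
        then have "(cmod q powr (t + 1) * w powr (- t)) * (cos (t * \<alpha>) * cos \<alpha> powr (2 * t))
            \<le> cmod q powr (t + 1) * w powr (- t)"
          by (intro mult_left_le) auto
        with main show ?thesis by (simp add: mult_ac)
      qed
      ultimately show ?thesis by (simp add: w_def)
    qed
  qed
qed

end
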